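(* Let $\Lambda$ be an arithmetic lattice and $\Gamma<\Lambda$ a torsion free, virtually unipotent subgroup. Then there exists a torsion free finite index subgroup $\Lambda_0$ of $\Lambda$ such that $\Gamma<\Lambda_0$.
   Context: An arithmetic lattice is a subgroup $\Lambda<\mathbf{G}(\mathbf{Q})$, where $\mathbf{G}<\mathrm{GL}_n$ is a linear algebraic group defined over $\mathbf{Q}$, commensurable with $\mathbf{G}(\mathbf{Z})=\mathbf{G}\cap\mathrm{GL}(n,\mathbf{Z})$; thus $\Lambda<\mathrm{GL}(n,\mathbf{Q})$. A subgroup of $\mathrm{GL}(n,\mathbf{C})$ is unipotent if it is conjugate in $\mathrm{GL}(n,\mathbf{C})$ into the group of upper triangular matrices with ones on the diagonal, and virtually unipotent if it has a finite index unipotent subgroup. *)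

theory Defs
  imports
    "HOL-Algebra.Coset"
    "HOL-Library.Poly_Mapping"
    "Jordan_Normal_Form.Matrix"
begin

section \<open>Matrix groups\<close>

definition GL :: "nat \<Rightarrow> complex mat monoid" where
  "GL n = units_of (ring_mat TYPE(complex) n ())"

lemma group_GL: "group (GL n)"
  unfolding GL_def by (intro monoid.units_group semiring.axioms(2) semiring_mat)

definition GL_Q :: "nat \<Rightarrow> complex mat set" where
  "GL_Q n = {A \<in> carrier (GL n). elements_mat A \<subseteq> \<rat>}"

definition GL_Z :: "nat \<Rightarrow> complex mat set" where
  "GL_Z n = {A \<in> carrier (GL n).
     elements_mat A \<subseteq> \<int> \<and> elements_mat (inv\<^bsub>GL n\<^esub> A) \<subseteq> \<int>}"

definition unitriangular :: "nat \<Rightarrow> complex mat set" where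
  "unitriangular n =
     {A \<in> carrier_mat n n. upper_triangular A \<and> (\<forall>i<n. A $$ (i, i) = 1)}"

section \<open>Linear algebraic groups defined over the rationals\<close>

text \<open>
  A polynomial with rational coefficients in variables of type 'v is a finitely supported map
  from monomials to coefficients, a monomial being a finitely supported map from variables to
  exponents.  The variable (i, j) stands for the matrix entry in row i and column j.
\<close>

type_synonym 'v rat_mpoly = "('v \<Rightarrow>\<^sub>0 nat) \<Rightarrow>\<^sub>0 rat"

definition eval_mpoly :: "'v rat_mpoly \<Rightarrow> ('v \<Rightarrow> complex) \<Rightarrow> complex" where
  "eval_mpoly p x =
     (\<Sum>m\<in>Poly_Mapping.keys p. of_rat (poly_mapping.lookup p m) *
        (\<Prod>v\<in>Poly_Mapping.keys m. x v ^ poly_mapping.lookup m v))"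

definition mpoly_vars :: "'v rat_mpoly \<Rightarrow> 'v set" where
  "mpoly_vars p = (\<Union>m\<in>Poly_Mapping.keys p. Poly_Mapping.keys m)"

text \<open>
  A subgroup of GL(n, C) cut out by rational polynomials in the matrix entries.  Allowing the
  inverse of the determinant as a further variable gives the same subsets of GL(n, C), as
  denominators can be cleared.  The bound on the variables matters, because \<^term>\<open>A $$ (i, j)\<close>
  is unspecified outside the index range of A.
\<close>

definition algebraic_group_over_Q :: "nat \<Rightarrow> complex mat set \<Rightarrow> bool" where
  "algebraic_group_over_Q n G \<longleftrightarrow>
     subgroup G (GL n) \<and>
     (\<exists>S :: (nat \<times> nat) rat_mpoly set.
        (\<forall>p\<in>S. mpoly_vars p \<subseteq> {..<n} \<times> {..<n}) \<and>
        G = {A \<in> carrier (GL n). \<forall>p\<in>S. eval_mpoly p (\<lambda>ij. A $$ ij) = 0})"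

section \<open>Arithmetic lattices\<close>

definition finite_index_subgroup :: "('a, 'b) monoid_scheme \<Rightarrow> 'a set \<Rightarrow> 'a set \<Rightarrow> bool" where
  "finite_index_subgroup G H K \<longleftrightarrow>
     subgroup H (G\<lparr>carrier := K\<rparr>) \<and> finite (rcosets\<^bsub>G\<lparr>carrier := K\<rparr>\<^esub> H)"

definition commensurable :: "('a, 'b) monoid_scheme \<Rightarrow> 'a set \<Rightarrow> 'a set \<Rightarrow> bool" where
  "commensurable G H K \<longleftrightarrow>
     finite_index_subgroup G (H \<inter> K) H \<and> finite_index_subgroup G (H \<inter> K) K"

definition arithmetic_lattice :: "nat \<Rightarrow> complex mat set \<Rightarrow> bool" where
  "arithmetic_lattice n \<Lambda> \<longleftrightarrow>
     (\<exists>G. algebraic_group_over_Q n G \<and>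
        subgroup \<Lambda> ((GL n)\<lparr>carrier := G \<inter> GL_Q n\<rparr>) \<and>
        commensurable (GL n) \<Lambda> (G \<inter> GL_Z n))"

section \<open>Torsion free and virtually unipotent subgroups\<close>

definition torsion_free :: "('a, 'b) monoid_scheme \<Rightarrow> 'a set \<Rightarrow> bool" where
  "torsion_free G H \<longleftrightarrow>
     (\<forall>x\<in>H. \<forall>k::nat. k > 0 \<longrightarrow> x [^]\<^bsub>G\<^esub> k = \<one>\<^bsub>G\<^esub> \<longrightarrow> x = \<one>\<^bsub>G\<^esub>)"

definition unipotent_subgroup :: "nat \<Rightarrow> complex mat set \<Rightarrow> bool" where
  "unipotent_subgroup n H \<longleftrightarrow>
     subgroup H (GL n) \<and>
     (\<exists>P\<in>carrier (GL n). \<forall>A\<in>H. P \<otimes>\<^bsub>GL n\<^esub> A \<otimes>\<^bsub>GL n\<^esub> inv\<^bsub>GL n\<^esub> P \<in> unitriangular n)"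

definition virtually_unipotent :: "nat \<Rightarrow> complex mat set \<Rightarrow> bool" where
  "virtually_unipotent n H \<longleftrightarrow>
     (\<exists>U. unipotent_subgroup n U \<and> finite_index_subgroup (GL n) U H)"

end

theory Submission
  imports Defs "Jordan_Normal_Form.Determinant"
begin

text \<open>
  The lattice \<open>\<Lambda>\<close> has bounded denominators, so it lies in a ring \<open>R\<close> of matrices that is a
  lattice in the additive sense; congruence modulo \<open>m\<close> means congruence modulo \<open>m R\<close>. The subgroup
  sought is \<open>\<Lambda>\<^sub>0 = \<Gamma> \<Lambda>(m)\<close>, with \<open>\<Lambda>(m)\<close> the congruence subgroup, for a suitable \<open>m\<close>.

  All torsion elements \<open>x\<close> of \<open>\<Lambda>\<close> satisfy \<open>x ^ E = 1\<close> for one \<open>E\<close>, because \<open>\<Lambda>(6)\<close> is torsion free.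
  If such an \<open>x\<close> is congruent to \<open>\<gamma> \<in> \<Gamma>\<close>, then \<open>\<gamma> ^ E\<close> is congruent to 1, and therefore it lies in the
  normal subgroup \<open>U\<close> of \<open>\<Gamma>\<close> acting trivially on the graded pieces of the flag defined by a normal
  unipotent subgroup of finite index. Artin--Rees for subgroups of \<open>R\<close> and descent along the flag
  produce \<open>v \<in> U\<close> with \<open>(\<gamma> v) ^ E = 1\<close>; as \<open>\<Gamma>\<close> is torsion free, \<open>\<gamma> \<in> U\<close> is unipotent. So \<open>x\<close> is
  unipotent modulo \<open>m\<close>, hence congruent to 1 modulo a number prime to \<open>E\<close>, hence equal to 1.
\<close>

lemma of_nat_left_commute: "z * (of_nat m * y) = of_nat m * (z * (y::'a::ring_1))"
  by (metis mult.assoc mult_of_nat_commute)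

lemma power_diff_one: "(x::'a::ring_1) ^ r - 1 = (\<Sum>i<r. x ^ i) * (x - 1)"
proof (induction r)
  case (Suc r)
  then show ?case
    by (simp add: distrib_right right_diff_distrib[of "x ^ r"] power_commutes flip: Suc)
qed simp

section \<open>Orders with integral coordinates\<close>

text \<open>The coordinates embed the additive group of \<open>R\<close> into Z^N without being
  asked to form a basis, so none has to be constructed. The price is that divisibility of all
  coordinates by \<open>m\<close> does not by itself give an element of \<open>m R\<close>;
  \<open>artin_rees\<close> bridges this gap, even for \<open>R\<close> itself.\<close>

locale lattice_ring =
  fixes R :: "'a::ring_1 set" and N :: nat and \<phi> :: "nat \<Rightarrow> 'a \<Rightarrow> int"
  assumes one_R [simp, intro]: "1 \<in> R"
    and diff_R [simp, intro]: "x \<in> R \<Longrightarrow> y \<in> R \<Longrightarrow> x - y \<in> R"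
    and mult_R [simp, intro]: "x \<in> R \<Longrightarrow> y \<in> R \<Longrightarrow> x * y \<in> R"
    and coord_add: "x \<in> R \<Longrightarrow> y \<in> R \<Longrightarrow> \<phi> i (x + y) = \<phi> i x + \<phi> i y"
    and coord_inj: "x \<in> R \<Longrightarrow> (\<And>i. i < N \<Longrightarrow> \<phi> i x = 0) \<Longrightarrow> x = 0"
begin

lemma zero_R [simp, intro]: "0 \<in> R"
  using diff_R[OF one_R one_R] by simp

lemma uminus_R [simp, intro]: "x \<in> R \<Longrightarrow> - x \<in> R"
  using diff_R[OF zero_R] by simp

lemma add_R [simp, intro]: "x \<in> R \<Longrightarrow> y \<in> R \<Longrightarrow> x + y \<in> R"
  using diff_R[of x "- y"] by simp

lemma power_R [simp, intro]: "x \<in> R \<Longrightarrow> x ^ k \<in> R"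
  by (induction k) auto

lemma of_nat_R [simp, intro]: "of_nat k \<in> R"
  by (induction k) auto

lemma of_int_R [simp, intro]: "of_int k \<in> R"
  by (cases k) auto

lemma sum_R [intro]: "(\<And>i. i \<in> I \<Longrightarrow> f i \<in> R) \<Longrightarrow> sum f I \<in> R"
  by (induction I rule: infinite_finite_induct) auto

lemma coord_0: "\<phi> i 0 = 0"
  using coord_add[of 0 0 i] by simp

lemma coord_minus: "x \<in> R \<Longrightarrow> \<phi> i (- x) = - \<phi> i x"
  using coord_add[of x "- x" i] coord_0[of i] by simp

lemma coord_diff: "x \<in> R \<Longrightarrow> y \<in> R \<Longrightarrow> \<phi> i (x - y) = \<phi> i x - \<phi> i y"
  using coord_add[of x "- y" i] by (simp add: coord_minus)

lemma coord_of_nat_mult: "x \<in> R \<Longrightarrow> \<phi> i (of_nat k * x) = int k * \<phi> i x"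
  by (induction k) (auto simp: coord_0 coord_add algebra_simps)

lemma coord_of_int_mult: "x \<in> R \<Longrightarrow> \<phi> i (of_int k * x) = k * \<phi> i x"
  using coord_minus[of "of_nat n * x" for n]
  by (cases k rule: int_cases2) (auto simp: coord_of_nat_mult)

lemma torsion_free_R: "x \<in> R \<Longrightarrow> of_nat k * x = 0 \<Longrightarrow> k > 0 \<Longrightarrow> x = 0"
proof (rule coord_inj)
  fix i assume "x \<in> R" "of_nat k * x = 0" "k > 0"
  then have "int k * \<phi> i x = 0"
    using coord_of_nat_mult[of x i k] coord_0 by simp
  then show "\<phi> i x = 0" using \<open>k > 0\<close> by simp
qed

section \<open>Additive subgroups of the order and Artin-Rees divisibility\<close>

definition additive_subgroup :: "'a set \<Rightarrow> bool" where
  "additive_subgroup B \<longleftrightarrow> B \<subseteq> R \<and> 0 \<in> B \<and> (\<forall>x\<in>B. \<forall>y\<in>B. x - y \<in> B)"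

lemma additive_subgroupD:
  assumes "additive_subgroup B"
  shows "B \<subseteq> R" "0 \<in> B" "x \<in> B \<Longrightarrow> y \<in> B \<Longrightarrow> x - y \<in> B" "x \<in> B \<Longrightarrow> - x \<in> B"
    "x \<in> B \<Longrightarrow> y \<in> B \<Longrightarrow> x + y \<in> B" "x \<in> B \<Longrightarrow> of_nat k * x \<in> B" "x \<in> B \<Longrightarrow> of_int j * x \<in> B"
proof -
  show 1: "B \<subseteq> R" "0 \<in> B" and 2: "x \<in> B \<Longrightarrow> y \<in> B \<Longrightarrow> x - y \<in> B" for x y
    using assms by (auto simp: additive_subgroup_def)
  show 3: "- x \<in> B" if "x \<in> B" for x
    using 2[OF 1(2) that] by simp
  show 4: "x + y \<in> B" if "x \<in> B" "y \<in> B" for x y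
    using 2[OF that(1) 3[OF that(2)]] by simp
  show 5: "of_nat k * x \<in> B" if "x \<in> B" for k x
    by (induction k) (auto simp: 1 4 that algebra_simps)
  show "of_int j * x \<in> B" if "x \<in> B" for x
    by (cases j rule: int_cases2) (auto simp: 3 5 that)
qed

text \<open>Induction on the number \<open>M\<close> of coordinates that may be nonzero on
  \<open>B\<close>. The last of them maps \<open>B\<close> onto an ideal of the integers;
  subtracting a multiple of an element over its generator leads to the subgroup where that
  coordinate vanishes.\<close>

lemma artin_rees:
  assumes "additive_subgroup B" "K > 0"
  shows "\<exists>m>0. \<forall>b\<in>B. (\<forall>i<N. int m dvd \<phi> i b) \<longrightarrow> (\<exists>c\<in>B. b = of_nat K * c)"
proof -
  have "\<exists>m>0. \<forall>b\<in>B. (\<forall>i<N. int m dvd \<phi> i b) \<longrightarrow> (\<exists>c\<in>B. b = of_nat K * c)"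
    if "M \<le> N" "additive_subgroup B" "\<forall>b\<in>B. \<forall>i<N. M \<le> i \<longrightarrow> \<phi> i b = 0" for M B
    using that
  proof (induction M arbitrary: B)
    case 0
    have "b = of_nat K * 0" if "b \<in> B" for b
      using coord_inj[of b] 0 that additive_subgroupD(1)[OF 0(2)] by auto
    with additive_subgroupD(2)[OF 0(2)] show ?case by (intro exI[of _ 1]) blast
  next
    case (Suc M)
    note B = additive_subgroupD[OF Suc.prems(2)]
    define B' where "B' = {b\<in>B. \<phi> M b = 0}"
    have B': "additive_subgroup B'"
      using B by (auto simp: additive_subgroup_def B'_def coord_0 coord_diff subset_iff)
    moreover have "\<forall>b\<in>B'. \<forall>i<N. M \<le> i \<longrightarrow> \<phi> i b = 0"
      using Suc.prems(3) by (auto simp: B'_def) (metis Suc_leI le_neq_implies_less)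
    ultimately obtain m' where m': "m' > 0"
      "\<And>b. b \<in> B' \<Longrightarrow> (\<forall>i<N. int m' dvd \<phi> i b) \<Longrightarrow> \<exists>c\<in>B'. b = of_nat K * c"
      using Suc.IH[of B'] Suc.prems(1) by auto
    show ?case
    proof (cases "\<forall>b\<in>B. \<phi> M b = 0")
      case True
      then have "B' = B" by (auto simp: B'_def)
      with m' show ?thesis by auto
    next
      case False
      define P where "P a \<longleftrightarrow> a > 0 \<and> (\<exists>b\<in>B. \<phi> M b = int a)" for a :: nat
      have "\<exists>a. P a"
      proof -
        from False obtain b where b: "b \<in> B" "\<phi> M b \<noteq> 0" by auto
        then have "\<phi> M (- b) = - \<phi> M b" "- b \<in> B" using B(1,4) by (auto simp: coord_minus)
        then show ?thesis
          unfolding P_def using b by (intro exI[of _ "nat \<bar>\<phi> M b\<bar>"]) (auto simp: abs_if)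
      qed
      \<comment> \<open>The least positive value generates the ideal of values of coordinate
        \<open>M\<close>, by division with remainder.\<close>
      define a where "a = (LEAST a. P a)"
      have Pa: "P a" unfolding a_def using \<open>\<exists>a. P a\<close> by (rule LeastI_ex)
      then obtain b0 where b0: "b0 \<in> B" "\<phi> M b0 = int a" "a > 0" by (auto simp: P_def)
      have a_dvd: "int a dvd \<phi> M b" if "b \<in> B" for b
      proof (rule ccontr)
        assume "\<not> int a dvd \<phi> M b"
        then have r: "\<phi> M b mod int a > 0"
          using b0(3) by (metis dvd_eq_mod_eq_0 of_nat_0_less_iff order_le_less pos_mod_sign)
        have "\<phi> M (b - of_int (\<phi> M b div int a) * b0) = \<phi> M b mod int a"
          using that b0 B(1) by (auto simp: coord_diff coord_of_int_mult subset_iff minus_div_mult_eq_mod)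
        then have "P (nat (\<phi> M b mod int a))"
          unfolding P_def using r B(3)[OF that B(7)[OF b0(1)]] by auto
        then have "a \<le> nat (\<phi> M b mod int a)" unfolding a_def by (rule Least_le)
        then show False using b0(3) pos_mod_bound[of "int a" "\<phi> M b"] by linarith
      qed
      show ?thesis
      \<comment> \<open>The factor \<open>a\<close> allows division by the generator,
        \<open>K\<close> makes the subtracted multiple of \<open>b0\<close> lie in
        \<open>K B\<close>, and \<open>m'\<close> keeps the coordinates of the difference divisible
        by \<open>m'\<close>, as the induction hypothesis demands.\<close>
      proof (intro exI[of _ "a * K * m'"] conjI ballI impI)
        show "0 < a * K * m'" using b0 m' \<open>K > 0\<close> by simp
        fix b assume b: "b \<in> B" and dv: "\<forall>i<N. int (a * K * m') dvd \<phi> i b"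
        have "M < N" using Suc.prems(1) by simp
        then obtain s where s: "\<phi> M b = int (a * K * m') * s" using dv by (meson dvdE)
        define t where "t = int m' * s"
        define b' where "b' = b - of_int (int K * t) * b0"
        have "b' \<in> B'"
          using b b0 B(1) B(3)[OF b B(7)[OF b0(1)]] s
          by (auto simp: B'_def b'_def coord_diff coord_of_int_mult subset_iff t_def simp del: of_int_mult)
        moreover have "int m' dvd \<phi> i b'" if "i < N" for i
        proof -
          have "int m' dvd \<phi> i b" using dv that by (metis dvd_mult_right of_nat_mult)
          then show ?thesis
            using b b0 B(1) by (auto simp: b'_def coord_diff coord_of_int_mult subset_iff t_def simp del: of_int_mult)
        qed
        ultimately obtain c where c: "c \<in> B'" "b' = of_nat K * c" using m'(2) by blast
        have "b = of_nat K * (c + of_int t * b0)"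
          using c(2) by (simp add: b'_def algebra_simps of_nat_left_commute)
        moreover have "c + of_int t * b0 \<in> B"
          using c(1) B(5)[OF _ B(7)[OF b0(1)]] by (auto simp: B'_def)
        ultimately show "\<exists>c\<in>B. b = of_nat K * c" by blast
      qed
    qed
  qed
  from this[OF order_refl assms(1)] show ?thesis by auto
qed

section \<open>Congruences modulo multiples of the order\<close>

definition congr :: "nat \<Rightarrow> 'a \<Rightarrow> 'a \<Rightarrow> bool" where
  "congr m x y \<longleftrightarrow> (\<exists>z\<in>R. x - y = of_nat m * z)"

lemma congr_refl [simp]: "congr m x x"
  by (auto simp: congr_def intro!: bexI[of _ 0])

lemma congrI: "z \<in> R \<Longrightarrow> x - y = of_nat m * z \<Longrightarrow> congr m x y"
  by (auto simp: congr_def)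

lemma congrE:
  assumes "congr m x y"
  obtains z where "z \<in> R" "x = y + of_nat m * z"
  using assms unfolding congr_def by (metis add.commute diff_add_cancel)

lemma congr_sym: "congr m x y \<Longrightarrow> congr m y x"
  by (elim congrE, rule_tac z = "- z" in congrI) auto

lemma congr_add: "congr m x y \<Longrightarrow> congr m x' y' \<Longrightarrow> congr m (x + x') (y + y')"
  by (elim congrE, rule_tac z = "z + za" in congrI) (auto simp: algebra_simps)

lemma congr_diff: "congr m x y \<Longrightarrow> congr m x' y' \<Longrightarrow> congr m (x - x') (y - y')"
  by (elim congrE, rule_tac z = "z - za" in congrI) (auto simp: algebra_simps)

lemma congr_trans [trans]: "congr m x y \<Longrightarrow> congr m y z \<Longrightarrow> congr m x z"
  using congr_add[of m x y y z] congr_diff[of m "x + y" "y + z" y y] by simp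

lemma congr_mult_right: "congr m x y \<Longrightarrow> z \<in> R \<Longrightarrow> congr m (x * z) (y * z)"
  by (elim congrE, rule_tac z = "za * z" in congrI) (auto simp: algebra_simps)

lemma congr_mult_left:
  assumes "congr m x y" "z \<in> R"
  shows "congr m (z * x) (z * y)"
proof -
  from assms(1) obtain w where w: "w \<in> R" "x = y + of_nat m * w" by (rule congrE)
  then show ?thesis
    using assms(2) by (intro congrI[of "z * w"]) (auto simp: distrib_left of_nat_left_commute)
qed

lemma congr_mult: "congr m x y \<Longrightarrow> congr m x' y' \<Longrightarrow> x' \<in> R \<Longrightarrow> y \<in> R \<Longrightarrow> congr m (x * x') (y * y')"
  by (meson congr_mult_left congr_mult_right congr_trans)

lemma congr_power: "congr m x y \<Longrightarrow> x \<in> R \<Longrightarrow> y \<in> R \<Longrightarrow> congr m (x ^ k) (y ^ k)"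
  by (induction k) (auto intro: congr_mult)

lemma congr_dvd: "congr m x y \<Longrightarrow> d dvd m \<Longrightarrow> congr d x y"
  unfolding congr_def by (auto elim!: dvdE simp: mult.assoc intro!: bexI)

lemma congr_coprime_cancel:
  assumes "congr m (of_nat e * x) 0" "coprime e m" "x \<in> R"
  shows "congr m x 0"
proof -
  from assms(1) obtain z where z: "z \<in> R" "of_nat e * x = of_nat m * z" by (auto simp: congr_def)
  obtain a b where ab: "a * int e + b * int m = 1"
    using assms(2) bezout_int[of "int e" "int m"] by auto
  have swap: "of_int j * (of_nat m * y) = of_nat m * (of_int j * y)" for j and y :: 'a
    by (rule of_nat_left_commute)
  have "x = of_int (a * int e + b * int m) * x" by (simp add: ab)
  also have "\<dots> = of_int a * (of_nat e * x) + of_int b * (of_nat m * x)"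
    by (simp add: distrib_right mult.assoc)
  also have "\<dots> = of_nat m * (of_int a * z + of_int b * x)"
    unfolding z(2) swap distrib_left ..
  finally show ?thesis using z(1) assms(3) unfolding congr_def by (auto intro!: bexI)
qed

section \<open>Congruences that force equality or unipotence\<close>

lemma congr_all_powers:
  assumes "x \<in> R" "m \<ge> 2" "\<And>k. congr (m ^ k) x 0"
  shows "x = 0"
proof (rule coord_inj[OF assms(1)])
  fix i
  have "int m ^ k dvd \<phi> i x" for k
    using assms(3)[of k] by (auto simp: congr_def coord_of_nat_mult simp flip: of_nat_power)
  \<comment> \<open>This exponent makes the power of \<open>m\<close> exceed the absolute value of
    the coordinate, so only 0 is divisible by it.\<close>
  then have dv: "int m ^ nat (\<bar>\<phi> i x\<bar> + 1) dvd \<phi> i x" by blast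
  have lt: "\<bar>\<phi> i x\<bar> < int m ^ nat (\<bar>\<phi> i x\<bar> + 1)"
  proof -
    have "nat (\<bar>\<phi> i x\<bar> + 1) < m ^ nat (\<bar>\<phi> i x\<bar> + 1)"
      using assms(2) by (intro power_gt_expt) simp
    then have "int (nat (\<bar>\<phi> i x\<bar> + 1)) < int m ^ nat (\<bar>\<phi> i x\<bar> + 1)"
      by (metis of_nat_less_iff of_nat_power)
    then show ?thesis by simp
  qed
  show "\<phi> i x = 0"
  proof (rule ccontr)
    assume "\<phi> i x \<noteq> 0"
    from dvd_imp_le_int[OF this dv] lt show False by simp
  qed
qed

text \<open>Modulo \<open>m\<close> the element \<open>S\<close> is the invertible scalar
  \<open>e\<close>, so \<open>S * x = 0\<close> makes \<open>x\<close> divisible by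
  \<open>m\<close>. As \<open>R\<close> is torsion free, the quotient is again killed by
  \<open>S\<close>; hence \<open>x\<close> is divisible by every power of \<open>m\<close>.\<close>

lemma coprime_congr_regular:
  assumes "S \<in> R" "x \<in> R" "congr m S (of_nat e)" "coprime e m" "m \<ge> 2" "S * x = 0"
  shows "x = 0"
proof (rule congr_all_powers[OF assms(2,5)])
  fix k show "congr (m ^ k) x 0"
  proof (induction k)
    case 0 then show ?case using assms(2) by (auto simp: congr_def)
  next
    case (Suc k)
    then obtain z where z: "z \<in> R" "x = of_nat (m ^ k) * z" by (auto simp: congr_def)
    have "of_nat (m ^ k) * (S * z) = S * x"
      unfolding z(2) of_nat_left_commute ..
    then have "of_nat (m ^ k) * (S * z) = 0" using assms(6) by simp
    then have "S * z = 0"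
      using torsion_free_R[of "S * z" "m ^ k"] assms(1,5) z(1) by simp
    then have "congr m (of_nat e * z) 0"
      using congr_mult_right[OF congr_sym[OF assms(3)] z(1)] by simp
    then have "congr m z 0" using assms(4) z(1) by (rule congr_coprime_cancel)
    then obtain w where w: "w \<in> R" "z = of_nat m * w" by (auto simp: congr_def)
    have "x = of_nat (m ^ Suc k) * w"
      unfolding z(2) w(2) power_Suc2 of_nat_mult mult.assoc ..
    then show ?case using w(1) by (auto simp: congr_def)
  qed
qed

lemma congr_sum_powers:
  assumes "congr m x 1" "x \<in> R"
  shows "congr m (\<Sum>i<r. x ^ i) (of_nat r)"
proof (induction r)
  case (Suc r)
  have "congr m (x ^ r) 1" using congr_power[OF assms(1,2) one_R, of r] by simp
  from congr_add[OF Suc this] show ?case by (simp add: add.commute)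
qed simp

text \<open>Factor \<open>x ^ r - 1\<close> as \<open>S * (x - 1)\<close> with \<open>S\<close> the
  geometric sum, which commutes with \<open>x - 1\<close> and is congruent to \<open>r\<close>. Then
  \<open>S ^ k\<close> can be cancelled by \<open>coprime_congr_regular\<close>.\<close>

lemma unipotent_of_power:
  assumes "congr m x 1" "x \<in> R" "coprime r m" "m \<ge> 2" "(x ^ r - 1) ^ k = 0"
  shows "(x - 1) ^ k = 0"
proof -
  define S where "S = (\<Sum>i<r. x ^ i)"
  have SR: "S \<in> R" using assms(2) by (auto simp: S_def)
  have comm: "S * (x - 1) = (x - 1) * S"
    by (simp add: S_def sum_distrib_left sum_distrib_right left_diff_distrib right_diff_distrib power_commutes sum_subtractf)
  have "(x ^ r - 1) ^ k = S ^ k * (x - 1) ^ k"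
    unfolding power_diff_one S_def[symmetric]
  proof (induction k)
    case (Suc k)
    have "(x - 1) * S ^ k = S ^ k * (x - 1)" by (metis comm power_commuting_commutes)
    then show ?case using Suc by (simp add: mult.assoc) (metis mult.assoc)
  qed simp
  moreover have "congr m (S ^ k) (of_nat (r ^ k))"
    using congr_power[OF congr_sum_powers[OF assms(1,2)] _ of_nat_R] SR unfolding S_def by simp
  ultimately show ?thesis
    using coprime_congr_regular[of "S ^ k" "(x - 1) ^ k" m "r ^ k"] assms SR by auto
qed

text \<open>The modulus 6 supplies two primes: modulo 2 the odd part of the order is removed, and
  modulo 3 the remaining power of 2.\<close>

lemma congr_6_torsion_free:
  assumes "congr 6 x 1" "x \<in> R" "x ^ r = 1" "r > 0"
  shows "x = 1"
proof -
  obtain a s where as: "r = 2 ^ a * s" "odd s"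
    using multiplicity_decompose'[of r 2] assms(4) by (metis odd_one not_gr0)
  have "x ^ 2 ^ a - 1 = 0"
  proof -
    have "congr 2 (x ^ 2 ^ a) 1"
      using congr_power[OF congr_dvd[OF assms(1), of 2] assms(2) one_R, of "2 ^ a"] by simp
    then show ?thesis
      using unipotent_of_power[of 2 "x ^ 2 ^ a" s 1] assms as by (simp flip: power_mult)
  qed
  then have "x ^ 2 ^ a = 1" by simp
  moreover have "coprime ((2::nat) ^ a) 3" by (simp add: coprime_left_2_iff_odd)
  ultimately show ?thesis
    using unipotent_of_power[of 3 x "2 ^ a" 1] congr_dvd[OF assms(1), of 3] assms(2) by simp
qed

section \<open>Finiteness of residues and a uniform torsion exponent\<close>

lemma additive_subgroup_R: "additive_subgroup R"
  by (auto simp: additive_subgroup_def)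

lemma finite_residues:
  assumes "m > 0"
  obtains f :: "'a \<Rightarrow> int list"
  where "finite (f ` R)" "\<And>x y. x \<in> R \<Longrightarrow> y \<in> R \<Longrightarrow> f x = f y \<Longrightarrow> congr m x y"
proof -
  obtain m1 where m1: "m1 > 0"
    "\<And>b. b \<in> R \<Longrightarrow> (\<forall>i<N. int m1 dvd \<phi> i b) \<Longrightarrow> \<exists>c\<in>R. b = of_nat m * c"
    using artin_rees[OF additive_subgroup_R assms] by auto
  define f where "f x = map (\<lambda>i. \<phi> i x mod int m1) [0..<N]" for x
  show thesis
  proof (rule that[of f])
    have "f ` R \<subseteq> {xs. set xs \<subseteq> {0..<int m1} \<and> length xs = N}"
      using m1(1) by (auto simp: f_def)
    then show "finite (f ` R)" by (rule finite_subset) (simp add: finite_lists_length_eq)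
  next
    fix x y assume xy: "x \<in> R" "y \<in> R" "f x = f y"
    have "int m1 dvd \<phi> i (x - y)" if "i < N" for i
      using xy that by (auto simp: f_def coord_diff mod_eq_dvd_iff)
    with m1(2)[of "x - y"] xy show "congr m x y" by (auto simp: congr_def)
  qed
qed

text \<open>By pigeonhole two of the powers with exponents 0 to \<open>C\<close> are congruent, so
  some positive exponent up to \<open>C\<close> gives 1 modulo \<open>m\<close>. The factorial of
  \<open>C\<close> is a common multiple of all these exponents.\<close>

lemma ex_congr_power_one:
  assumes "m > 0"
  shows "\<exists>E>0. \<forall>x\<in>R. \<forall>y\<in>R. x * y = 1 \<longrightarrow> y * x = 1 \<longrightarrow> congr m (x ^ E) 1"
proof -
  obtain f :: "'a \<Rightarrow> int list" where f: "finite (f ` R)"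
    "\<And>x y. x \<in> R \<Longrightarrow> y \<in> R \<Longrightarrow> f x = f y \<Longrightarrow> congr m x y"
    using finite_residues[OF assms] by metis
  define C where "C = card (f ` R)"
  have "congr m (x ^ fact C) 1" if xy: "x \<in> R" "y \<in> R" "x * y = 1" "y * x = 1" for x y
  proof -
    have "card ((\<lambda>i. f (x ^ i)) ` {..C}) \<le> C"
      unfolding C_def using xy(1) by (intro card_mono f) auto
    then have "\<not> inj_on (\<lambda>i. f (x ^ i)) {..C}" by (intro pigeonhole) simp
    then obtain i j where ij: "i < j" "j \<le> C" "f (x ^ i) = f (x ^ j)"
      unfolding inj_on_def by (metis atMost_iff linorder_neqE_nat)
    then have "congr m (x ^ j) (x ^ i)" using f(2) xy(1) by simp
    then have "congr m (y ^ i * x ^ j) (y ^ i * x ^ i)" using xy by (intro congr_mult_left) auto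
    moreover have "y ^ i * x ^ i = 1" using xy(4) by (rule left_right_inverse_power)
    moreover have "x ^ j = x ^ i * x ^ (j - i)" using ij(1) by (simp flip: power_add)
    ultimately have c: "congr m (x ^ (j - i)) 1" by (simp flip: mult.assoc)
    have "j - i dvd fact C" using ij by (intro dvd_fact) auto
    then obtain q where "fact C = (j - i) * q" by (auto elim: dvdE)
    then show ?thesis
      using congr_power[OF c, of q] xy(1) by (simp add: power_mult)
  qed
  then show ?thesis by (intro exI[of _ "fact C"]) auto
qed

definition unit_group :: "'a set \<Rightarrow> bool" where
  "unit_group X \<longleftrightarrow> X \<subseteq> R \<and> 1 \<in> X \<and> (\<forall>x\<in>X. \<forall>y\<in>X. x * y \<in> X) \<and>
     (\<forall>x\<in>X. \<exists>y\<in>X. x * y = 1 \<and> y * x = 1)"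

lemma unit_groupD:
  assumes "unit_group X"
  shows "x \<in> X \<Longrightarrow> x \<in> R" "1 \<in> X" "x \<in> X \<Longrightarrow> y \<in> X \<Longrightarrow> x * y \<in> X" "x \<in> X \<Longrightarrow> x ^ k \<in> X"
proof -
  show 1: "x \<in> X \<Longrightarrow> x \<in> R" "1 \<in> X" and 2: "x \<in> X \<Longrightarrow> y \<in> X \<Longrightarrow> x * y \<in> X" for x y
    using assms by (auto simp: unit_group_def)
  show "x \<in> X \<Longrightarrow> x ^ k \<in> X" by (induction k) (auto simp: 1 2)
qed

lemma unit_group_inverse:
  assumes "unit_group X" "x \<in> X"
  obtains y where "y \<in> X" "x * y = 1" "y * x = 1"
  using assms by (auto simp: unit_group_def)

text \<open>With \<open>E\<close> chosen so that \<open>x ^ E\<close> is congruent to 1 modulo 6 for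
  every unit, a torsion element has \<open>x ^ E\<close> both torsion and in the torsion free range
  of \<open>congr_6_torsion_free\<close>.\<close>

lemma ex_torsion_exponent:
  "\<exists>E>0. \<forall>X x r. unit_group X \<longrightarrow> x \<in> X \<longrightarrow> r > 0 \<longrightarrow> x ^ r = 1 \<longrightarrow> x ^ E = 1"
proof -
  obtain E where E: "E > 0"
    "\<And>x y. x \<in> R \<Longrightarrow> y \<in> R \<Longrightarrow> x * y = 1 \<Longrightarrow> y * x = 1 \<Longrightarrow> congr 6 (x ^ E) 1"
    using ex_congr_power_one[of 6] by auto
  have "x ^ E = 1" if x: "unit_group X" "x \<in> X" "r > 0" "x ^ r = 1" for X x r
  proof -
    obtain y where "y \<in> X" "x * y = 1" "y * x = 1" using x(1,2) by (rule unit_group_inverse)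
    then have "congr 6 (x ^ E) 1" using E(2) unit_groupD(1)[OF x(1)] x(2) by blast
    moreover have "(x ^ E) ^ r = 1" using x(4) by (metis mult.commute power_mult power_one)
    ultimately show ?thesis
      using congr_6_torsion_free x(3) unit_groupD(1)[OF x(1,2)] by blast
  qed
  with E(1) show ?thesis by blast
qed

text \<open>The exponent of nilpotency modulo \<open>m\<close> is lowered to 1. If
  \<open>x - 1\<close> kills \<open>D = (x - 1) ^ Suc k\<close> modulo \<open>m\<close>, the
  geometric sum \<open>S\<close> acts on \<open>D\<close> as the scalar \<open>E\<close>; but
  \<open>S * (x - 1) = x ^ E - 1 = 0\<close>, so \<open>E D\<close> vanishes modulo
  \<open>m\<close>, and \<open>E\<close> is invertible there.\<close>

lemma torsion_congr_nilpotent: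
  assumes "x \<in> R" "x ^ E = 1" "coprime E m" "m \<ge> 2" "congr m ((x - 1) ^ k) 0"
  shows "x = 1"
proof -
  define S where "S = (\<Sum>i<E. x ^ i)"
  have S: "S \<in> R" "S * (x - 1) = 0"
    using assms(1,2) power_diff_one[of x E] by (auto simp: S_def)
  have step: "congr m (x - 1) 0" if "congr m ((x - 1) ^ Suc k) 0" for k
    using that
  proof (induction k)
    case (Suc k)
    define D where "D = (x - 1) ^ Suc k"
    have D: "D \<in> R" using assms(1) unfolding D_def by auto
    have "congr m (x * D) D"
      using congr_add[OF Suc.prems congr_refl[of m D]] by (simp add: D_def algebra_simps)
    then have pw: "congr m (x ^ i * D) D" for i
    proof (induction i)
      case (Suc i)
      have "congr m (x * (x ^ i * D)) (x * D)" using Suc assms(1) by (intro congr_mult_left) auto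
      with Suc.prems show ?case by (auto simp: mult.assoc intro: congr_trans)
    qed simp
    have "congr m (S * D) (of_nat E * D)"
    proof -
      have "congr m (\<Sum>i<r. x ^ i * D) (of_nat r * D)" for r
      proof (induction r)
        case (Suc r)
        from congr_add[OF Suc pw[of r]] show ?case by (simp add: distrib_right add.commute)
      qed simp
      then show ?thesis by (simp add: S_def sum_distrib_right)
    qed
    moreover have "S * D = 0"
      unfolding D_def power_Suc using S(2) by (simp flip: mult.assoc)
    ultimately have "congr m (of_nat E * D) 0" using congr_sym by metis
    from congr_coprime_cancel[OF this assms(3) D] show ?case
      unfolding D_def by (rule Suc.IH)
  qed simp
  have "congr m (x - 1) 0"
  proof (cases k)
    \<comment> \<open>Here the hypothesis reads that 1 is congruent to 0, so everything is.\<close>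
    case 0
    then have "congr m 1 0" using assms(5) by simp
    from congr_mult_right[OF this, of "x - 1"] show ?thesis using assms(1) by simp
  qed (use step assms(5) in auto)
  then have "congr m x 1" using congr_add[of m "x - 1" 0 1 1] by simp
  from unipotent_of_power[OF this assms(1,3,4), of 1] assms(2) show ?thesis by simp
qed

end

section \<open>The flag of a normal unipotent subgroup\<close>

text \<open>Finite index enters as the common exponent \<open>e\<close>, and normality as a
  commutation rule because the ring type has no inverse operation. Unipotence is expressed later by
  the hypothesis that 1 lies in some \<open>flag n\<close>.\<close>

locale unipotent_flag = lattice_ring R N \<phi>
  for R :: "'a::ring_1 set" and N \<phi> +
  fixes \<Gamma> U\<^sub>0 :: "'a set" and e :: nat
  assumes \<Gamma>_group: "unit_group \<Gamma>"
    and U\<^sub>0_subset: "U\<^sub>0 \<subseteq> \<Gamma>"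
    and U\<^sub>0_normal: "u \<in> U\<^sub>0 \<Longrightarrow> \<gamma> \<in> \<Gamma> \<Longrightarrow> \<exists>u'\<in>U\<^sub>0. u * \<gamma> = \<gamma> * u'"
    and e_pos: "e > 0"
    and power_e: "\<gamma> \<in> \<Gamma> \<Longrightarrow> \<gamma> ^ e \<in> U\<^sub>0"
begin

lemmas \<Gamma> = unit_groupD[OF \<Gamma>_group]

text \<open>
  \<open>flag j\<close> consists of the ring elements killed by every product of \<open>j\<close> factors \<open>u - 1\<close>. Taking
  right annihilators inside the ring itself makes the flag a chain of right ideals that is
  invariant under left multiplication by \<open>\<Gamma>\<close>, so no vector space needs to be chosen.
\<close>

primrec flag :: "nat \<Rightarrow> 'a set" where
  "flag 0 = {0}"
| "flag (Suc j) = {A \<in> R. \<forall>u\<in>U\<^sub>0. (u - 1) * A \<in> flag j}"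

lemma flag_R: "A \<in> flag j \<Longrightarrow> A \<in> R"
  by (cases j) auto

lemma flag_subgroup: "additive_subgroup (flag j)"
  by (induction j) (auto simp: additive_subgroup_def right_diff_distrib)

lemmas flag = additive_subgroupD(2-)[OF flag_subgroup]

lemma flag_mult_right: "A \<in> flag j \<Longrightarrow> B \<in> R \<Longrightarrow> A * B \<in> flag j"
  by (induction j arbitrary: A) (auto simp flip: mult.assoc)

lemma flag_mult_left: "\<gamma> \<in> \<Gamma> \<Longrightarrow> A \<in> flag j \<Longrightarrow> \<gamma> * A \<in> flag j"
proof (induction j arbitrary: A)
  case (Suc j)
  have "(u - 1) * (\<gamma> * A) \<in> flag j" if u: "u \<in> U\<^sub>0" for u
  proof -
    obtain u' where u': "u' \<in> U\<^sub>0" "u * \<gamma> = \<gamma> * u'" using U\<^sub>0_normal[OF u Suc.prems(1)] by auto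
    have "(u - 1) * (\<gamma> * A) = \<gamma> * ((u' - 1) * A)"
      using u'(2) by (simp add: algebra_simps) (metis mult.assoc)
    then show ?thesis using Suc u'(1) by auto
  qed
  then show ?case using Suc.prems \<Gamma>(1) by auto
qed simp

text \<open>Natural numbers are central and \<open>R\<close> is torsion free, so a factor
  \<open>k\<close> can be cancelled after all the multiplications by \<open>u - 1\<close>. Thus the
  quotients by the flag are torsion free, which allows \<open>e\<close> and \<open>E\<close> to be
  cancelled in them.\<close>

lemma flag_saturated: "x \<in> R \<Longrightarrow> k > 0 \<Longrightarrow> of_nat k * x \<in> flag j \<Longrightarrow> x \<in> flag j"
proof (induction j arbitrary: x)
  case 0 then show ?case using torsion_free_R by auto
next
  case (Suc j)
  have "(u - 1) * x \<in> flag j" if "u \<in> U\<^sub>0" for u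
    using Suc.prems Suc.IH[of "(u - 1) * x"] that U\<^sub>0_subset \<Gamma>(1)
    by (auto simp: of_nat_left_commute)
  then show ?case using Suc.prems by auto
qed

lemma flag_Suc: "A \<in> flag j \<Longrightarrow> A \<in> flag (Suc j)"
proof (induction j arbitrary: A)
  case (Suc j)
  then show ?case using flag_R by fastforce
qed auto

section \<open>The subgroup acting trivially on the graded pieces\<close>

definition U :: "'a set" where
  "U = {\<gamma> \<in> \<Gamma>. \<forall>j. \<forall>A\<in>flag (Suc j). (\<gamma> - 1) * A \<in> flag j}"

lemma U_\<Gamma>: "u \<in> U \<Longrightarrow> u \<in> \<Gamma>" and U_flag: "u \<in> U \<Longrightarrow> A \<in> flag (Suc j) \<Longrightarrow> (u - 1) * A \<in> flag j"
  by (auto simp: U_def simp del: flag.simps)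

lemma U_R: "u \<in> U \<Longrightarrow> u \<in> R"
  using U_\<Gamma> \<Gamma>(1) by blast

lemma U_group: "unit_group U"
proof -
  have "a * b \<in> U" if ab: "a \<in> U" "b \<in> U" for a b
  proof -
    have "(a * b - 1) * A \<in> flag j" if "A \<in> flag (Suc j)" for A j
    proof -
      have "(a * b - 1) * A = (a - 1) * (b * A) + (b - 1) * A" by (simp add: algebra_simps)
      then show ?thesis
        using ab that U_flag flag_mult_left[OF U_\<Gamma>] flag(4) by (simp del: flag.simps)
    qed
    then show ?thesis using ab \<Gamma>(3) unfolding U_def by (simp del: flag.simps)
  qed
  moreover have "\<exists>b\<in>U. a * b = 1 \<and> b * a = 1" if a: "a \<in> U" for a
  proof -
    obtain b where b: "b \<in> \<Gamma>" "a * b = 1" "b * a = 1"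
      using unit_group_inverse[OF \<Gamma>_group U_\<Gamma>[OF a]] .
    have "(b - 1) * A \<in> flag j" if "A \<in> flag (Suc j)" for A j
    proof -
      have "(b - 1) * A = - (b * ((a - 1) * A))"
        using b(3) by (simp add: algebra_simps flip: mult.assoc)
      then show ?thesis
        using flag(3)[OF flag_mult_left[OF b(1) U_flag[OF a that]]] by simp
    qed
    then show ?thesis using b unfolding U_def by (auto simp del: flag.simps)
  qed
  ultimately show ?thesis
    unfolding unit_group_def using U_R \<Gamma>(2) flag(1) by (auto simp: U_def simp del: flag.simps)
qed

lemma U_normal: "u \<in> U \<Longrightarrow> \<gamma> \<in> \<Gamma> \<Longrightarrow> \<exists>u'\<in>U. u * \<gamma> = \<gamma> * u'"
proof -
  assume u: "u \<in> U" and \<gamma>: "\<gamma> \<in> \<Gamma>"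
  obtain \<delta> where \<delta>: "\<delta> \<in> \<Gamma>" "\<gamma> * \<delta> = 1" "\<delta> * \<gamma> = 1"
    using unit_group_inverse[OF \<Gamma>_group \<gamma>] .
  have "(\<delta> * u * \<gamma> - 1) * A \<in> flag j" if "A \<in> flag (Suc j)" for A j
  proof -
    have "(\<delta> * u * \<gamma> - 1) * A = \<delta> * ((u - 1) * (\<gamma> * A))"
      using \<delta>(3) by (simp add: algebra_simps flip: mult.assoc)
    then show ?thesis
      using flag_mult_left[OF \<delta>(1) U_flag[OF u flag_mult_left[OF \<gamma> that]]] by simp
  qed
  then have "\<delta> * u * \<gamma> \<in> U" using \<Gamma>(3) \<delta>(1) \<gamma> U_\<Gamma>[OF u] unfolding U_def by (simp del: flag.simps)
  moreover have "u * \<gamma> = \<gamma> * (\<delta> * u * \<gamma>)" using \<delta>(2) by (simp flip: mult.assoc)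
  ultimately show ?thesis by blast
qed

lemma U_power_coset: "\<gamma> \<in> \<Gamma> \<Longrightarrow> v \<in> U \<Longrightarrow> \<exists>w\<in>U. (\<gamma> * v) ^ t = \<gamma> ^ t * w"
proof (induction t)
  case 0 then show ?case using unit_groupD(2)[OF U_group] by (auto intro: bexI[of _ 1])
next
  case (Suc t)
  then obtain w where w: "w \<in> U" "(\<gamma> * v) ^ t = \<gamma> ^ t * w" by auto
  obtain v' where v': "v' \<in> U" "v * \<gamma> ^ t = \<gamma> ^ t * v'"
    using U_normal[OF Suc.prems(2) \<Gamma>(4)[OF Suc.prems(1)]] by auto
  have "(\<gamma> * v) ^ Suc t = \<gamma> * (v * \<gamma> ^ t) * w" by (simp add: w mult.assoc)
  also have "\<dots> = \<gamma> ^ Suc t * (v' * w)" by (simp add: v' mult.assoc)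
  finally show ?case using unit_groupD(3)[OF U_group v'(1) w(1)] by blast
qed

text \<open>This is the binomial expansion to first order: \<open>g - 1\<close> lies in
  \<open>flag (Suc k)\<close>, and each further factor \<open>g - 1\<close> pushes a term down into
  \<open>flag k\<close>.\<close>

lemma U_power_flag:
  assumes "g \<in> U" "g - 1 \<in> flag (Suc k)"
  shows "g ^ t - 1 - of_nat t * (g - 1) \<in> flag k"
proof (induction t)
  case 0 then show ?case using flag(1) by simp
next
  case (Suc t)
  have "g ^ t - 1 \<in> flag (Suc k)"
    using flag(4)[OF flag_Suc[OF Suc] flag(5)[OF assms(2), of t]] by (simp del: flag.simps)
  then have "(g - 1) * (g ^ t - 1) \<in> flag k" using U_flag[OF assms(1)] by blast
  from flag(4)[OF this Suc] show ?case by (simp add: algebra_simps)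
qed

text \<open>Each factor \<open>u - 1\<close> moves 1 down the flag by one step, and
  \<open>flag 0\<close> is zero.\<close>

lemma U_nilpotent:
  assumes "1 \<in> flag n" "u \<in> U"
  shows "(u - 1) ^ n = 0"
proof -
  have "k \<le> n \<Longrightarrow> (u - 1) ^ k \<in> flag (n - k)" for k
  proof (induction k)
    case (Suc k)
    then have "n - k = Suc (n - Suc k)" by simp
    with Suc U_flag[OF assms(2)] show ?case by (simp del: flag.simps)
  qed (use assms(1) in auto)
  from this[of n] show ?thesis by simp
qed

text \<open>Since \<open>e\<close> is prime to \<open>e + 1\<close> and \<open>\<gamma> ^ e\<close>
  is unipotent, so is \<open>\<gamma>\<close>. On a graded piece \<open>\<gamma>\<close> is then
  both unipotent and of finite order, hence trivial because the piece is torsion free.\<close>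

lemma congr_imp_U:
  assumes "1 \<in> flag n" "\<gamma> \<in> \<Gamma>" "congr (e + 1) \<gamma> 1"
  shows "\<gamma> \<in> U"
proof -
  have \<gamma>R: "\<gamma> \<in> R" using \<Gamma>(1) assms(2) .
  have U\<^sub>0_U: "\<gamma> ^ e \<in> U" using power_e[OF assms(2)] U\<^sub>0_subset by (auto simp: U_def)
  have nil: "(\<gamma> - 1) ^ n = 0"
    using unipotent_of_power[OF assms(3) \<gamma>R, of e n] U_nilpotent[OF assms(1) U\<^sub>0_U] e_pos by simp
  have flag_\<gamma>: "(\<gamma> - 1) * A \<in> flag j" if "A \<in> flag j" for A j
    using flag(2)[OF flag_mult_left[OF assms(2) that] that] by (simp add: algebra_simps)
  \<comment> \<open>If \<open>(\<gamma> - 1) ^ 2\<close> kills \<open>C\<close> modulo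
    \<open>flag j\<close>, then \<open>\<gamma> ^ t * C\<close> is \<open>C + t D\<close> there. For
    \<open>t = e\<close> the left side is \<open>C\<close>, so \<open>e D\<close> and by saturation
    \<open>D\<close> lie in \<open>flag j\<close>.\<close>
  have key: "(\<gamma> - 1) * C \<in> flag j"
    if C: "C \<in> flag (Suc j)" "(\<gamma> - 1) * ((\<gamma> - 1) * C) \<in> flag j" for C j
  proof -
    define D where "D = (\<gamma> - 1) * C"
    have D: "D \<in> R" unfolding D_def using \<gamma>R flag_R[OF C(1)] by auto
    have "\<gamma> ^ t * D - D \<in> flag j" for t
    proof (induction t)
      case (Suc t)
      have "\<gamma> ^ Suc t * D - D = \<gamma> * (\<gamma> ^ t * D - D) + (\<gamma> - 1) * D"
        by (simp add: algebra_simps)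
      then show ?case
        using flag(4)[OF flag_mult_left[OF assms(2) Suc], of "(\<gamma> - 1) * D"] C(2) by (simp add: D_def)
    qed (use flag(1) in simp)
    then have pw: "\<gamma> ^ t * C - C - of_nat t * D \<in> flag j" for t
    proof (induction t)
      case (Suc t)
      have "\<gamma> ^ Suc t * C - C - of_nat (Suc t) * D
          = (\<gamma> ^ t * C - C - of_nat t * D) + (\<gamma> ^ t * D - D)"
        by (simp add: D_def algebra_simps power_commutes flip: mult.assoc)
      then show ?case using flag(4)[OF Suc.IH[OF Suc.prems] Suc.prems[of t]] by (simp only:)
    qed (use flag(1) in simp)
    have "(\<gamma> ^ e - 1) * C \<in> flag j" using U_flag[OF U\<^sub>0_U C(1)] .
    from flag(2)[OF this pw[of e]] have "of_nat e * D \<in> flag j" by (simp add: algebra_simps)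
    from flag_saturated[OF D e_pos this] show ?thesis by (simp add: D_def)
  qed
  have "(\<gamma> - 1) * A \<in> flag j" if A: "A \<in> flag (Suc j)" for A j
  proof -
    have mem: "(\<gamma> - 1) ^ i * A \<in> flag (Suc j)" for i
      using flag_\<gamma>[of _ "Suc j"] A by (induction i) (auto simp: mult.assoc simp del: flag.simps)
    \<comment> \<open>Nilpotency puts a high power into \<open>flag j\<close>; \<open>key\<close>
      strips the surplus factors one by one.\<close>
    have "(\<gamma> - 1) ^ Suc i * A \<in> flag j \<Longrightarrow> (\<gamma> - 1) * A \<in> flag j" for i
    proof (induction i)
      case (Suc i)
      from key[OF mem[of i]] Suc show ?case by (simp add: mult.assoc)
    qed simp
    moreover have "(\<gamma> - 1) ^ Suc n * A \<in> flag j" using nil flag(1) by simp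
    ultimately show ?thesis by blast
  qed
  then show ?thesis using assms(2) unfolding U_def by blast
qed

text \<open>Modulo \<open>flag k\<close> the map from \<open>g\<close> to \<open>g - 1\<close> is a
  homomorphism on these \<open>g\<close>. Adding \<open>flag k\<close> therefore gives an additive
  subgroup, to which \<open>artin_rees\<close> applies; the elements \<open>g - 1\<close> alone need
  not be closed under subtraction.\<close>

definition layer :: "nat \<Rightarrow> 'a set" where
  "layer k = {w + (g - 1) |w g. w \<in> flag k \<and> g \<in> U \<and> g - 1 \<in> flag (Suc k)}"

lemma layer_subgroup: "additive_subgroup (layer k)"
  unfolding additive_subgroup_def
proof (intro conjI ballI)
  show "layer k \<subseteq> R" using flag_R U_R by (auto simp: layer_def simp del: flag.simps)
  show "0 \<in> layer k"
    unfolding layer_def mem_Collect_eq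
    using flag(1)[of k] flag(1)[of "Suc k"] unit_groupD(2)[OF U_group]
    by (intro exI[of _ 0] exI[of _ 1]) (simp del: flag.simps)
  fix x y assume "x \<in> layer k" "y \<in> layer k"
  then obtain w g w' g' where
    x: "x = w + (g - 1)" "w \<in> flag k" "g \<in> U" "g - 1 \<in> flag (Suc k)" and
    y: "y = w' + (g' - 1)" "w' \<in> flag k" "g' \<in> U" "g' - 1 \<in> flag (Suc k)"
    unfolding layer_def by blast
  obtain h where h: "h \<in> U" "g' * h = 1" "h * g' = 1" using unit_group_inverse[OF U_group y(3)] .
  have gh: "g * h \<in> U" using unit_groupD(3)[OF U_group x(3) h(1)] .
  have "(g - 1 - (g' - 1)) * h \<in> flag (Suc k)"
    using flag_mult_right[OF flag(2)[OF x(4) y(4)] U_R[OF h(1)]] .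
  then have "g * h - 1 \<in> flag (Suc k)" using h(2) by (simp add: algebra_simps del: flag.simps)
  \<comment> \<open>With \<open>h\<close> inverse to \<open>g'\<close>, the difference
    \<open>g - g'\<close> is \<open>g * h - 1\<close> up to the product
    \<open>(g * h - 1) * (g' - 1)\<close>, which lies in \<open>flag k\<close>.\<close>
  moreover have "x - y = (w - w' + (g * h - 1) * (g' - 1)) + (g * h - 1)"
    using h(3) by (simp add: x(1) y(1) algebra_simps)
  moreover have "w - w' + (g * h - 1) * (g' - 1) \<in> flag k"
    using flag(4)[OF flag(2)[OF x(2) y(2)] U_flag[OF gh y(4)]] .
  ultimately show "x - y \<in> layer k" using gh unfolding layer_def by blast
qed

section \<open>Congruence modulo a step of the flag, and descent along the flag\<close>

definition flag_eq :: "nat \<Rightarrow> 'a \<Rightarrow> 'a \<Rightarrow> bool" where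
  "flag_eq k x y \<longleftrightarrow> x - y \<in> flag k"

lemma flag_eq_refl [simp]: "flag_eq k x x"
  using flag(1) by (simp add: flag_eq_def)

lemma flag_eq_sym: "flag_eq k x y \<Longrightarrow> flag_eq k y x"
  using flag(3) unfolding flag_eq_def by (metis minus_diff_eq)

lemma flag_eq_trans [trans]: "flag_eq k x y \<Longrightarrow> flag_eq k y z \<Longrightarrow> flag_eq k x z"
  using flag(4)[of "x - y" k "y - z"] by (simp add: flag_eq_def)

lemma flag_eq_mult_left: "flag_eq k x y \<Longrightarrow> \<gamma> \<in> \<Gamma> \<Longrightarrow> flag_eq k (\<gamma> * x) (\<gamma> * y)"
  using flag_mult_left[of \<gamma> "x - y" k] by (simp add: flag_eq_def algebra_simps)

lemma flag_eq_mult_right: "flag_eq k x y \<Longrightarrow> z \<in> R \<Longrightarrow> flag_eq k (x * z) (y * z)"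
  using flag_mult_right[of "x - y" k z] by (simp add: flag_eq_def algebra_simps)

text \<open>The usual rule for powers of commuting elements. \<open>flag k\<close> is a right ideal
  stable only under left multiplication by \<Gamma>, so the left factors must stay in
  \<Gamma>.\<close>

lemma flag_eq_power_mult:
  assumes "h \<in> \<Gamma>" "v \<in> \<Gamma>" "flag_eq k (v * h) (h * v)"
  shows "flag_eq k ((h * v) ^ t) (h ^ t * v ^ t)"
proof (induction t)
  case (Suc t)
  note [simp] = \<Gamma>(1,3,4) assms(1,2)
  have comm: "flag_eq k (v * h ^ t) (h ^ t * v)" for t
  proof (induction t)
    case (Suc t)
    have "flag_eq k (v * h * h ^ t) (h * v * h ^ t)" by (intro flag_eq_mult_right assms) simp
    also have "flag_eq k (h * v * h ^ t) (h * (h ^ t * v))"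
      unfolding mult.assoc by (intro flag_eq_mult_left Suc) simp
    finally show ?case by (simp add: mult.assoc)
  qed simp
  have "flag_eq k (h * v * (h * v) ^ t) (h * v * (h ^ t * v ^ t))"
    by (intro flag_eq_mult_left Suc) simp
  also have "flag_eq k (h * v * (h ^ t * v ^ t)) (h * ((h ^ t * v) * v ^ t))"
    using flag_eq_mult_left[OF flag_eq_mult_right[OF comm[of t], of "v ^ t"], of h]
    by (simp add: mult.assoc)
  finally show ?case by (simp add: mult.assoc)
qed simp

text \<open>
  If \<open>\<gamma> ^ E\<close> lies in \<open>U\<close> and is close to 1, then modulo the next step of the flag it is an \<open>E\<close>-th
  power \<open>v ^ E\<close>, and \<open>v\<close> commutes with \<open>\<gamma>\<close> there because the flag is saturated. Hence
  \<open>(\<gamma> * inverse v) ^ E\<close> lies one step deeper.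
\<close>

lemma flag_descent:
  assumes tf: "\<And>\<gamma> k. \<gamma> \<in> \<Gamma> \<Longrightarrow> k > 0 \<Longrightarrow> \<gamma> ^ k = 1 \<Longrightarrow> \<gamma> = 1" and E: "E > 0"
  shows "\<exists>m>0. \<forall>\<gamma>\<in>\<Gamma>. \<gamma> ^ E \<in> U \<longrightarrow> \<gamma> ^ E - 1 \<in> flag k \<longrightarrow> congr m (\<gamma> ^ E) 1 \<longrightarrow> \<gamma> \<in> U"
proof (induction k)
  case 0
  \<comment> \<open>At the bottom of the flag \<open>\<gamma> ^ E = 1\<close>, and torsion freeness
    of \<Gamma> gives \<open>\<gamma> = 1\<close>.\<close>
  have "\<gamma> \<in> U" if "\<gamma> \<in> \<Gamma>" "\<gamma> ^ E - 1 \<in> flag 0" for \<gamma>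
    using tf[OF that(1) E] that(2) unit_groupD(2)[OF U_group] by simp
  then show ?case by (intro exI[of _ 1]) blast
next
  case (Suc k)
  then obtain m' where m': "m' > 0"
    "\<And>\<gamma>. \<gamma> \<in> \<Gamma> \<Longrightarrow> \<gamma> ^ E \<in> U \<Longrightarrow> \<gamma> ^ E - 1 \<in> flag k \<Longrightarrow> congr m' (\<gamma> ^ E) 1 \<Longrightarrow> \<gamma> \<in> U"
    by blast
  obtain s where s: "s > 0"
    "\<And>x y. x \<in> R \<Longrightarrow> y \<in> R \<Longrightarrow> x * y = 1 \<Longrightarrow> y * x = 1 \<Longrightarrow> congr m' (x ^ s) 1"
    using ex_congr_power_one[OF m'(1)] by blast
  \<comment> \<open>The factor \<open>E\<close> provides the \<open>E\<close>-th root modulo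
    \<open>flag k\<close>. The factor \<open>s\<close> lets this root be an \<open>s\<close>-th
    power \<open>g ^ s\<close>, hence congruent to 1 modulo \<open>m'\<close>, so that the induction
    hypothesis applies to the corrected element.\<close>
  obtain m'' where m'': "m'' > 0"
    "\<And>b. b \<in> layer k \<Longrightarrow> (\<forall>i<N. int m'' dvd \<phi> i b) \<Longrightarrow> \<exists>c\<in>layer k. b = of_nat (E * s) * c"
    using artin_rees[OF layer_subgroup, of "E * s" k] E s(1) by auto
  have "\<gamma> \<in> U" if \<gamma>: "\<gamma> \<in> \<Gamma>" and u: "\<gamma> ^ E \<in> U" "\<gamma> ^ E - 1 \<in> flag (Suc k)"
    and cong: "congr (m'' * m') (\<gamma> ^ E) 1" for \<gamma>
  proof -
    define u where "u = \<gamma> ^ E"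
    note u = u[folded u_def]
    have "u - 1 \<in> layer k"
      using u flag(1)[of k] unfolding layer_def by (force simp del: flag.simps)
    moreover have "int m'' dvd \<phi> i (u - 1)" for i
    proof -
      have "congr m'' u 1" using congr_dvd[OF cong, of m''] by (simp add: u_def)
      then show ?thesis by (auto simp: congr_def coord_of_nat_mult)
    qed
    ultimately obtain c where c: "c \<in> layer k" "u - 1 = of_nat (E * s) * c" using m''(2) by blast
    from c(1) obtain w g where wg: "c = w + (g - 1)" "w \<in> flag k" "g \<in> U" "g - 1 \<in> flag (Suc k)"
      unfolding layer_def by blast
    define v where "v = g ^ s"
    have v: "v \<in> U" unfolding v_def by (rule unit_groupD(4)[OF U_group wg(3)])
    obtain v' where v': "v' \<in> U" "v * v' = 1" "v' * v = 1" using unit_group_inverse[OF U_group v] .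
    have vs: "v - 1 - of_nat s * (g - 1) \<in> flag k"
      unfolding v_def by (rule U_power_flag[OF wg(3,4)])
    have v1: "v - 1 \<in> flag (Suc k)"
      using flag(4)[OF flag_Suc[OF vs] flag(5)[OF wg(4), of s]] by (simp del: flag.simps)
    define d where "d = u - 1 - of_nat E * (v - 1)"
    have "d = of_nat (E * s) * w - of_nat E * (v - 1 - of_nat s * (g - 1))"
      unfolding d_def c(2) wg(1) by (simp add: algebra_simps)
    then have d: "d \<in> flag k"
      using flag(2)[OF flag(5)[OF wg(2)] flag(5)[OF vs]] by metis
    have uv: "flag_eq k u (v ^ E)"
      using flag(2)[OF d U_power_flag[OF v v1, of E]] by (simp add: flag_eq_def d_def)
    have \<gamma>v: "flag_eq k (\<gamma> * v) (v * \<gamma>)"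
    proof -
      have u\<gamma>: "\<gamma> * u = u * \<gamma>" by (simp add: u_def power_commutes)
      \<comment> \<open>Since \<open>\<gamma>\<close> commutes with its power \<open>u\<close>, only
        the error term \<open>d\<close> and the multiple of \<open>v\<close> contribute to the
        commutator of \<open>d\<close> with \<open>\<gamma>\<close>.\<close>
      have "of_nat E * (\<gamma> * v - v * \<gamma>) = d * \<gamma> - \<gamma> * d"
        unfolding d_def by (simp add: algebra_simps of_nat_left_commute u\<gamma> mult_of_nat_commute[of E \<gamma>, symmetric])
      then have "of_nat E * (\<gamma> * v - v * \<gamma>) \<in> flag k"
        using flag(2)[OF flag_mult_right[OF d \<Gamma>(1)[OF \<gamma>]] flag_mult_left[OF \<gamma> d]] by simp
      moreover have "\<gamma> * v - v * \<gamma> \<in> R" using \<Gamma>(1)[OF \<gamma>] U_R[OF v] by simp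
      ultimately show ?thesis unfolding flag_eq_def using flag_saturated E by simp
    qed
    define h where "h = \<gamma> * v'"
    have h: "h \<in> \<Gamma>" "h * v = \<gamma>"
      using \<gamma> U_\<Gamma>[OF v'(1)] v'(3) by (auto simp: h_def mult.assoc intro: \<Gamma>(3))
    have "flag_eq k (v * h) (h * v)"
    proof -
      have "flag_eq k (v * \<gamma> * v') (\<gamma> * v * v')"
        by (intro flag_eq_mult_right flag_eq_sym[OF \<gamma>v] U_R v')
      then show ?thesis using v' by (simp add: h_def mult.assoc)
    qed
    from flag_eq_power_mult[OF h(1) U_\<Gamma>[OF v] this, of E]
    have "flag_eq k u (h ^ E * v ^ E)" by (simp add: h(2) u_def)
    then have "flag_eq k (h ^ E * v ^ E) (v ^ E)" using uv flag_eq_sym flag_eq_trans by blast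
    from flag_eq_mult_right[OF this power_R[OF U_R[OF v'(1)]], of E]
    have "flag_eq k (h ^ E) 1"
      using left_right_inverse_power[OF v'(2), of E] by (simp add: mult.assoc)
    moreover have "h ^ E \<in> U"
      using U_power_coset[OF \<gamma> v'(1), of E] unit_groupD(3)[OF U_group] u(1)
      by (auto simp: h_def u_def)
    moreover have "congr m' (h ^ E) 1"
    proof -
      obtain g' where g': "g' \<in> U" "g * g' = 1" "g' * g = 1" using unit_group_inverse[OF U_group wg(3)] .
      have "congr m' v 1" unfolding v_def using s(2)[of g g'] g' wg(3) U_R by blast
      from congr_mult_left[OF this U_R[OF v'(1)]] have "congr m' v' 1"
        using v'(3) by (simp add: congr_sym)
      from congr_mult_left[OF this \<Gamma>(1)[OF \<gamma>]] have "congr m' h \<gamma>" by (simp add: h_def)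
      then have "congr m' (h ^ E) (\<gamma> ^ E)" using \<Gamma>(1) \<gamma> h(1) by (intro congr_power) auto
      also have "congr m' (\<gamma> ^ E) 1" using congr_dvd[OF cong, of m'] by simp
      finally show ?thesis .
    qed
    ultimately have "h \<in> U" using m'(2)[OF h(1)] by (simp add: flag_eq_def)
    then show ?thesis using unit_groupD(3)[OF U_group _ v] h(2) by metis
  qed
  then show ?case using m'(1) m''(1) by (intro exI[of _ "m'' * m'"]) auto
qed

theorem torsion_free_thickening:
  assumes tf: "\<And>\<gamma> k. \<gamma> \<in> \<Gamma> \<Longrightarrow> k > 0 \<Longrightarrow> \<gamma> ^ k = 1 \<Longrightarrow> \<gamma> = 1"
    and nil: "1 \<in> flag n" and \<Lambda>: "unit_group \<Lambda>"
  shows "\<exists>m>0. \<forall>x\<in>\<Lambda>. \<forall>\<gamma>\<in>\<Gamma>. \<forall>r>0. congr m x \<gamma> \<longrightarrow> x ^ r = 1 \<longrightarrow> x = 1"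
proof -
  obtain E where E: "E > 0" "\<And>x r. x \<in> \<Lambda> \<Longrightarrow> r > 0 \<Longrightarrow> x ^ r = 1 \<Longrightarrow> x ^ E = 1"
    using ex_torsion_exponent \<Lambda> by blast
  have "\<exists>m>0. \<forall>\<gamma>\<in>\<Gamma>. \<gamma> ^ E \<in> U \<longrightarrow> \<gamma> ^ E - 1 \<in> flag n \<longrightarrow> congr m (\<gamma> ^ E) 1 \<longrightarrow> \<gamma> \<in> U"
    using E(1) by (intro flag_descent) (auto intro: tf)
  then obtain m where m: "m > 0"
    "\<And>\<gamma>. \<gamma> \<in> \<Gamma> \<Longrightarrow> \<gamma> ^ E \<in> U \<Longrightarrow> \<gamma> ^ E - 1 \<in> flag n \<Longrightarrow> congr m (\<gamma> ^ E) 1 \<Longrightarrow> \<gamma> \<in> U"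
    by auto
  have flag_n: "A \<in> flag n" if "A \<in> R" for A using flag_mult_right[OF nil that] by simp
  \<comment> \<open>The three factors of the modulus serve in turn: \<open>e + 1\<close> puts
    \<open>\<gamma> ^ E\<close> into \<open>U\<close>, \<open>m\<close> then puts
    \<open>\<gamma>\<close> into \<open>U\<close>, and \<open>E + 1\<close>, being prime to
    \<open>E\<close>, turns nilpotency of \<open>\<gamma> - 1\<close> into
    \<open>x = 1\<close>.\<close>
  have "x = 1" if x: "x \<in> \<Lambda>" "r > 0" "x ^ r = 1" and \<gamma>: "\<gamma> \<in> \<Gamma>"
    and cong: "congr (m * (e + 1) * (E + 1)) x \<gamma>" for x \<gamma> r
  proof -
    have R: "x \<in> R" "\<gamma> \<in> R" using unit_groupD(1)[OF \<Lambda> x(1)] \<Gamma>(1)[OF \<gamma>] .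
    have xE: "x ^ E = 1" using E(2) x by blast
    have \<gamma>E: "congr d (\<gamma> ^ E) 1" if "d dvd m * (e + 1) * (E + 1)" for d
      using congr_power[OF congr_sym[OF congr_dvd[OF cong that]] R(2,1), of E] by (simp add: xE)
    have "\<gamma> ^ E \<in> U"
      by (rule congr_imp_U[OF nil \<Gamma>(4)[OF \<gamma>] \<gamma>E]) (rule dvd_mult2, rule dvd_triv_right)
    moreover have "\<gamma> ^ E - 1 \<in> flag n" using R(2) by (simp add: flag_n)
    moreover have "congr m (\<gamma> ^ E) 1" by (rule \<gamma>E) simp
    ultimately have "\<gamma> \<in> U" by (rule m(2)[OF \<gamma>])
    then have "(\<gamma> - 1) ^ n = 0" by (rule U_nilpotent[OF nil])
    moreover have "congr (E + 1) ((x - 1) ^ n) ((\<gamma> - 1) ^ n)"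
      using R congr_dvd[OF cong dvd_triv_right] by (intro congr_power congr_diff) auto
    ultimately show ?thesis
      using torsion_congr_nilpotent[OF R(1) xE, of "E + 1" n] E(1) by simp
  qed
  then show ?thesis using m(1) by (intro exI[of _ "m * (e + 1) * (E + 1)"]) auto
qed

end

section \<open>Matrices as a type of class ring\<close>

text \<open>
  The ring of \<open>n \<times> n\<close> matrices is not a type, since \<open>n\<close> is a term. For \<open>n > 0\<close> it embeds unitally
  into the additive endomorphisms of complex sequences, a matrix acting on each of the
  consecutive blocks of length \<open>n\<close>.
\<close>

typedef endo = "{f :: (nat \<Rightarrow> complex) \<Rightarrow> nat \<Rightarrow> complex.
    \<forall>x y. f (\<lambda>i. x i + y i) = (\<lambda>i. f x i + f y i)}"
  by (rule exI[of _ "\<lambda>x. x"]) simp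

setup_lifting type_definition_endo

instantiation endo :: ring_1
begin

lift_definition zero_endo :: endo is "\<lambda>x i. 0" by simp
lift_definition one_endo :: endo is "\<lambda>x. x" by simp
lift_definition plus_endo :: "endo \<Rightarrow> endo \<Rightarrow> endo" is "\<lambda>f g x i. f x i + g x i"
  by (simp add: algebra_simps)
lift_definition minus_endo :: "endo \<Rightarrow> endo \<Rightarrow> endo" is "\<lambda>f g x i. f x i - g x i"
  by (simp add: algebra_simps)
lift_definition uminus_endo :: "endo \<Rightarrow> endo" is "\<lambda>f x i. - f x i"
  by simp
lift_definition times_endo :: "endo \<Rightarrow> endo \<Rightarrow> endo" is "\<lambda>f g x. f (g x)"
  by simp

instance
proof
  show "(0::endo) \<noteq> 1"
    by transfer (auto simp: fun_eq_iff intro!: exI[of _ "\<lambda>_. 1"])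
qed (transfer; simp add: fun_eq_iff algebra_simps)+

end

lift_definition mat_endo :: "nat \<Rightarrow> complex mat \<Rightarrow> endo" is
  "\<lambda>n A x i. \<Sum>j<n. A $$ (i mod n, j) * x (n * (i div n) + j)"
  by (simp add: algebra_simps sum.distrib)

context
  fixes n :: nat
  assumes n: "n > 0"
begin

lemma mat_endo_add:
  "A \<in> carrier_mat n n \<Longrightarrow> B \<in> carrier_mat n n \<Longrightarrow> mat_endo n (A + B) = mat_endo n A + mat_endo n B"
  using n by transfer (auto simp: fun_eq_iff algebra_simps sum.distrib)

lemma mat_endo_diff:
  "A \<in> carrier_mat n n \<Longrightarrow> B \<in> carrier_mat n n \<Longrightarrow> mat_endo n (A - B) = mat_endo n A - mat_endo n B"
  using n by transfer (auto simp: fun_eq_iff algebra_simps sum_subtractf)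

lemma mat_endo_one: "mat_endo n (1\<^sub>m n) = 1"
proof (transfer fixing: n, intro ext)
  fix x :: "nat \<Rightarrow> complex" and i
  have "(\<Sum>j<n. 1\<^sub>m n $$ (i mod n, j) * x (n * (i div n) + j))
      = (\<Sum>j<n. if j = i mod n then x (n * (i div n) + j) else 0)"
    using n by (intro sum.cong) auto
  then show "(\<Sum>j<n. 1\<^sub>m n $$ (i mod n, j) * x (n * (i div n) + j)) = x i"
    using n by simp
qed

lemma mat_endo_mult:
  "A \<in> carrier_mat n n \<Longrightarrow> B \<in> carrier_mat n n \<Longrightarrow> mat_endo n (A * B) = mat_endo n A * mat_endo n B"
proof (transfer fixing: n, intro ext)
  fix A B :: "complex mat" and x :: "nat \<Rightarrow> complex" and i
  assume AB: "A \<in> carrier_mat n n" "B \<in> carrier_mat n n"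
  let ?y = "\<lambda>k. x (n * (i div n) + k)"
  have "(\<Sum>k<n. (A * B) $$ (i mod n, k) * ?y k)
      = (\<Sum>k<n. \<Sum>j<n. A $$ (i mod n, j) * B $$ (j, k) * ?y k)"
    using AB n by (auto simp: scalar_prod_def lessThan_atLeast0 sum_distrib_right intro!: sum.cong)
  also have "\<dots> = (\<Sum>j<n. A $$ (i mod n, j) * (\<Sum>k<n. B $$ (j, k) * ?y k))"
    by (subst sum.swap) (simp add: sum_distrib_left mult.assoc)
  also have "\<dots> = (\<Sum>j<n. A $$ (i mod n, j) *
      (\<Sum>k<n. B $$ ((n * (i div n) + j) mod n, k) * x (n * ((n * (i div n) + j) div n) + k)))"
    using n by (intro sum.cong) auto
  finally show "(\<Sum>k<n. (A * B) $$ (i mod n, k) * ?y k) = \<dots>" .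
qed

lemma mat_endo_inj: "inj_on (mat_endo n) (carrier_mat n n)"
proof (intro inj_onI eq_matI)
  fix A B assume AB: "A \<in> carrier_mat n n" "B \<in> carrier_mat n n" "mat_endo n A = mat_endo n B"
  then show "dim_row A = dim_row B" "dim_col A = dim_col B" by auto
  fix i j assume "i < dim_row B" "j < dim_col B"
  then have ij: "i < n" "j < n" using AB by auto
  \<comment> \<open>Applied to a unit sequence supported in the first block, the endomorphism
    returns a column of the matrix.\<close>
  have "Rep_endo (mat_endo n C) (\<lambda>k. if k = j then 1 else 0) i = C $$ (i, j)" for C
    using ij by (simp add: mat_endo.rep_eq if_distrib cong: if_cong)
  with AB(3) show "A $$ (i, j) = B $$ (i, j)" by metis
qed

end

section \<open>Subgroups of finite index and denominators\<close>

lemma GL_carrier: "A \<in> carrier (GL n) \<Longrightarrow> A \<in> carrier_mat n n"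
  by (auto simp: GL_def units_of_carrier Units_def ring_mat_simps)

lemma GL_mult [simp]: "A \<otimes>\<^bsub>GL n\<^esub> B = A * B"
  by (simp add: GL_def units_of_mult ring_mat_simps)

lemma GL_one [simp]: "\<one>\<^bsub>GL n\<^esub> = 1\<^sub>m n"
  by (simp add: GL_def units_of_one ring_mat_simps)

lemma GL_inv:
  assumes "A \<in> carrier (GL n)"
  shows "inv\<^bsub>GL n\<^esub> A \<in> carrier_mat n n" "A * inv\<^bsub>GL n\<^esub> A = 1\<^sub>m n" "inv\<^bsub>GL n\<^esub> A * A = 1\<^sub>m n"
  using group.inv_closed[OF group_GL assms] group.r_inv[OF group_GL assms]
    group.l_inv[OF group_GL assms] by (auto intro: GL_carrier)

lemma elements_mat_subset_iff:
  assumes "A \<in> carrier_mat n n"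
  shows "elements_mat A \<subseteq> S \<longleftrightarrow> (\<forall>i<n. \<forall>j<n. A $$ (i, j) \<in> S)"
proof (intro iffI allI impI subsetI)
  fix i j assume "elements_mat A \<subseteq> S" "i < n" "j < n"
  then show "A $$ (i, j) \<in> S" using elements_matI[OF assms \<open>i < n\<close> \<open>j < n\<close> refl] by blast
next
  fix x assume "\<forall>i<n. \<forall>j<n. A $$ (i, j) \<in> S" "x \<in> elements_mat A"
  then show "x \<in> S" using elements_matD[of x A] assms by auto
qed

lemma mat_mult_index:
  assumes "A \<in> carrier_mat n n" "B \<in> carrier_mat n n" "i < n" "j < n"
  shows "(A * B) $$ (i, j) = (\<Sum>k<n. A $$ (i, k) * B $$ (k, j))"
  using assms by (auto simp: scalar_prod_def lessThan_atLeast0 intro!: sum.cong)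

text \<open>The determinant is nonzero already over the rationals, so an inverse with rational
  entries exists; uniqueness identifies it with the complex one.\<close>

lemma GL_Q_inv:
  assumes "A \<in> GL_Q n"
  shows "inv\<^bsub>GL n\<^esub> A \<in> GL_Q n"
proof -
  have A: "A \<in> carrier (GL n)" "A \<in> carrier_mat n n"
    and rat: "\<And>i j. i < n \<Longrightarrow> j < n \<Longrightarrow> A $$ (i, j) \<in> \<rat>"
    using assms GL_carrier by (auto simp: GL_Q_def elements_mat_subset_iff)
  have "\<forall>i j. \<exists>q. i < n \<longrightarrow> j < n \<longrightarrow> A $$ (i, j) = of_rat q"
    using rat by (meson Rats_cases)
  then obtain q where q: "\<And>i j. i < n \<Longrightarrow> j < n \<Longrightarrow> A $$ (i, j) = of_rat (q i j)" by metis
  define A' where "A' = mat n n (\<lambda>(i, j). q i j)"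
  have A': "A' \<in> carrier_mat n n" "A = map_mat of_rat A'"
    using A(2) q by (auto simp: A'_def intro!: eq_matI)
  have "det A \<noteq> 0"
    using A(1) unit_imp_det_non_zero[of A n "()"] by (simp add: GL_def units_of_carrier)
  then have "det A' \<noteq> 0" unfolding A'(2) of_rat_hom.hom_det by auto
  from det_non_zero_imp_unit[OF A'(1) this, of "()"]
  obtain B' where B': "B' \<in> carrier_mat n n" "A' * B' = 1\<^sub>m n"
    by (auto simp: Units_def ring_mat_simps)
  let ?B = "map_mat of_rat B' :: complex mat"
  have B: "?B \<in> carrier_mat n n" using B'(1) by simp
  have "A * ?B = 1\<^sub>m n"
    unfolding A'(2) of_rat_hom.mat_hom_mult[OF A'(1) B'(1), symmetric] B'(2) of_rat_hom.mat_hom_one ..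
  have "inv\<^bsub>GL n\<^esub> A = inv\<^bsub>GL n\<^esub> A * (A * ?B)"
    unfolding \<open>A * ?B = 1\<^sub>m n\<close> using GL_inv[OF A(1)] by simp
  also have "\<dots> = ?B"
    using GL_inv[OF A(1)] A(2) B by (simp flip: assoc_mult_mat)
  finally have "inv\<^bsub>GL n\<^esub> A = ?B" .
  then show ?thesis
    using group.inv_closed[OF group_GL A(1)] B'(1) by (auto simp: GL_Q_def elements_mat_map)
qed

lemma subgroup_GL_Q: "subgroup (GL_Q n) (GL n)"
proof (rule group.subgroupI[OF group_GL])
  show "GL_Q n \<subseteq> carrier (GL n)" by (auto simp: GL_Q_def)
  have "1\<^sub>m n \<in> carrier (GL n)" using monoid.one_closed[OF group.is_monoid[OF group_GL[of n]]] by simp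
  then have "1\<^sub>m n \<in> GL_Q n" by (auto simp: GL_Q_def elements_mat_subset_iff)
  then show "GL_Q n \<noteq> {}" by auto
  show "inv\<^bsub>GL n\<^esub> A \<in> GL_Q n" if "A \<in> GL_Q n" for A using that by (rule GL_Q_inv)
  show "A \<otimes>\<^bsub>GL n\<^esub> B \<in> GL_Q n" if "A \<in> GL_Q n" "B \<in> GL_Q n" for A B
  proof -
    have AB: "A \<in> carrier (GL n)" "B \<in> carrier (GL n)" "A \<in> carrier_mat n n" "B \<in> carrier_mat n n"
      using that GL_carrier by (auto simp: GL_Q_def)
    have "A * B \<in> carrier (GL n)"
      using monoid.m_closed[OF group.is_monoid[OF group_GL] AB(1,2)] by simp
    moreover have "(A * B) $$ (i, j) \<in> \<rat>" if "i < n" "j < n" for i j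
    proof -
      have "A $$ (i, k) \<in> \<rat>" "B $$ (k, j) \<in> \<rat>" if "k < n" for k
        using \<open>A \<in> GL_Q n\<close> \<open>B \<in> GL_Q n\<close> \<open>i < n\<close> \<open>j < n\<close> that AB(3,4)
        by (auto simp: GL_Q_def elements_mat_subset_iff)
      then show ?thesis
        unfolding mat_mult_index[OF AB(3,4) that] by (intro Rats_sum Rats_mult) auto
    qed
    ultimately show ?thesis
      using elements_mat_subset_iff[OF mult_carrier_mat[OF AB(3,4)]] by (simp add: GL_Q_def)
  qed
qed

lemma arithmetic_lattice_subgroup:
  assumes "arithmetic_lattice n \<Lambda>"
  shows "subgroup \<Lambda> (GL n)"
  using assms unfolding arithmetic_lattice_def algebraic_group_over_Q_def
  using group.incl_subgroup[OF group_GL group.subgroups_Inter_pair[OF group_GL _ subgroup_GL_Q]]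
  by blast

section \<open>Finite index in terms of functions with finitely many values\<close>

lemma finite_index_residues:
  assumes "group (G\<lparr>carrier := K\<rparr>)" "finite_index_subgroup G H K"
  shows "\<exists>f::'a \<Rightarrow> 'a set. finite (f ` K) \<and>
    (\<forall>x\<in>K. \<forall>y\<in>K. f x = f y \<longrightarrow> (\<exists>h\<in>H. y = h \<otimes>\<^bsub>G\<^esub> x))"
proof (intro exI[of _ "\<lambda>x. H #>\<^bsub>G\<lparr>carrier := K\<rparr>\<^esub> x"] conjI ballI impI)
  let ?K = "G\<lparr>carrier := K\<rparr>"
  have "(\<lambda>x. H #>\<^bsub>?K\<^esub> x) ` K = rcosets\<^bsub>?K\<^esub> H" by (auto simp: RCOSETS_def)
  then show "finite ((\<lambda>x. H #>\<^bsub>?K\<^esub> x) ` K)"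
    using assms(2) by (simp add: finite_index_subgroup_def)
  fix x y assume xy: "x \<in> K" "y \<in> K" "H #>\<^bsub>?K\<^esub> x = H #>\<^bsub>?K\<^esub> y"
  then have "y \<in> H #>\<^bsub>?K\<^esub> x"
    using group.repr_independenceD[OF assms(1), of H y x] assms(2)
    by (simp add: finite_index_subgroup_def)
  then show "\<exists>h\<in>H. y = h \<otimes>\<^bsub>G\<^esub> x" by (auto simp: r_coset_def)
qed

text \<open>Every fibre of \<open>f\<close> lies in a single coset, so choosing a point in each
  fibre reaches all cosets. The function may be finer than the partition into cosets, as residues
  modulo \<open>m\<close> are.\<close>

lemma finite_index_subgroupI:
  assumes "group (G\<lparr>carrier := K\<rparr>)" "subgroup H (G\<lparr>carrier := K\<rparr>)" "finite (f ` K)"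
    and eq: "\<And>x y. x \<in> K \<Longrightarrow> y \<in> K \<Longrightarrow> f x = f y \<Longrightarrow> \<exists>h\<in>H. y = h \<otimes>\<^bsub>G\<^esub> x"
  shows "finite_index_subgroup G H K"
proof -
  let ?K = "G\<lparr>carrier := K\<rparr>"
  define r where "r v = H #>\<^bsub>?K\<^esub> (SOME x. x \<in> K \<and> f x = v)" for v
  have "H #>\<^bsub>?K\<^esub> x = r (f x)" if x: "x \<in> K" for x
  proof -
    define y where "y = (SOME y. y \<in> K \<and> f y = f x)"
    have y: "y \<in> K \<and> f y = f x" unfolding y_def by (rule someI[of _ x]) (use x in auto)
    then obtain h where "h \<in> H" "x = h \<otimes>\<^bsub>G\<^esub> y" using eq[of y x] x by auto
    then have "x \<in> H #>\<^bsub>?K\<^esub> y" by (auto simp: r_coset_def)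
    from group.repr_independence[OF assms(1) this _ assms(2)] y show ?thesis
      by (simp add: r_def y_def)
  qed
  then have "rcosets\<^bsub>?K\<^esub> H \<subseteq> r ` f ` K" by (auto simp: RCOSETS_def)
  then have "finite (rcosets\<^bsub>?K\<^esub> H)" by (rule finite_subset) (simp add: assms(3))
  then show ?thesis using assms(2) by (simp add: finite_index_subgroup_def)
qed

text \<open>Pigeonhole on cosets of the powers of \<open>x\<close>. As \<open>H\<close> need not be
  normal, the number of cosets may fail as an exponent, but its factorial is a multiple of every
  exponent that occurs.\<close>

lemma finite_index_power:
  fixes G :: "('a, 'b) monoid_scheme"
  assumes "group G" "subgroup K G" "finite_index_subgroup G H K"
  shows "\<exists>e>0. \<forall>x\<in>K. x [^]\<^bsub>G\<^esub> (e::nat) \<in> H"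
proof -
  interpret G: group G by fact
  have K: "group (G\<lparr>carrier := K\<rparr>)" by (rule G.subgroup_imp_group) fact
  have HK: "subgroup H (G\<lparr>carrier := K\<rparr>)" using assms(3) by (simp add: finite_index_subgroup_def)
  have H: "subgroup H G" by (rule G.incl_subgroup[OF assms(2) HK])
  from finite_index_residues[OF K assms(3)] obtain f :: "'a \<Rightarrow> 'a set" where f: "finite (f ` K)"
    "\<forall>x\<in>K. \<forall>y\<in>K. f x = f y \<longrightarrow> (\<exists>h\<in>H. y = h \<otimes>\<^bsub>G\<^esub> x)"
    by (elim exE conjE)
  define C where "C = card (f ` K)"
  have "x [^]\<^bsub>G\<^esub> (fact C :: nat) \<in> H" if x: "x \<in> K" for x
  proof -
    have xG: "x \<in> carrier G" using x subgroup.subset[OF assms(2)] by auto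
    have pw: "x [^]\<^bsub>G\<^esub> i \<in> K" for i :: nat
      by (induction i) (auto simp: subgroup.one_closed[OF assms(2)] subgroup.m_closed[OF assms(2)] x)
    have "card ((\<lambda>i::nat. f (x [^]\<^bsub>G\<^esub> i)) ` {..C}) \<le> C"
      unfolding C_def using pw by (intro card_mono f) auto
    then have "\<not> inj_on (\<lambda>i::nat. f (x [^]\<^bsub>G\<^esub> i)) {..C}" by (intro pigeonhole) simp
    then obtain i j where ij: "i < j" "j \<le> C" "f (x [^]\<^bsub>G\<^esub> i) = f (x [^]\<^bsub>G\<^esub> j)"
      unfolding inj_on_def by (metis atMost_iff linorder_neqE_nat)
    obtain h where h: "h \<in> H" "x [^]\<^bsub>G\<^esub> j = h \<otimes>\<^bsub>G\<^esub> x [^]\<^bsub>G\<^esub> i"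
      using f(2) pw ij(3) by (metis (no_types))
    have "x [^]\<^bsub>G\<^esub> j = x [^]\<^bsub>G\<^esub> (j - i) \<otimes>\<^bsub>G\<^esub> x [^]\<^bsub>G\<^esub> i"
      using ij(1) xG by (simp add: G.nat_pow_mult)
    then have "x [^]\<^bsub>G\<^esub> (j - i) = h"
      using h xG subgroup.mem_carrier[OF H h(1)] by simp
    with h have "x [^]\<^bsub>G\<^esub> (j - i) \<in> H" by simp
    moreover have "j - i dvd fact C" using ij by (intro dvd_fact) auto
    then obtain q where q: "fact C = (j - i) * q" by (auto elim: dvdE)
    moreover have "y [^]\<^bsub>G\<^esub> q \<in> H" if "y \<in> H" for y and q :: nat
      by (induction q) (auto simp: subgroup.one_closed[OF H] subgroup.m_closed[OF H] that)
    ultimately show ?thesis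
      using G.nat_pow_pow[OF xG, of "j - i" q] by metis
  qed
  then show ?thesis by (intro exI[of _ "fact C"]) auto
qed

section \<open>Bounded denominators of an arithmetic lattice\<close>

lemma common_denominator:
  assumes "finite T" "T \<subseteq> (\<rat> :: complex set)"
  shows "\<exists>D>0. \<forall>t\<in>T. of_nat D * t \<in> \<int>"
  using assms
proof (induction T)
  case empty then show ?case by (intro exI[of _ 1]) simp
next
  case (insert t T)
  then obtain D where D: "D > 0" "\<And>t. t \<in> T \<Longrightarrow> of_nat D * t \<in> \<int>" by auto
  from insert.prems obtain a b where ab: "b > 0" "t = of_int a / of_int b"
    by (auto elim: Rats_cases')
  have "of_nat (D * nat b) * s \<in> \<int>" if s: "s \<in> insert t T" for s
  proof (cases "s = t")
    case True
    have "of_nat (nat b) = (of_int b :: complex)" using ab(1) by simp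
    then have "of_nat (D * nat b) * s = of_nat D * of_int a"
      unfolding True ab(2) using ab(1) by simp
    then show ?thesis by (simp only: Ints_mult Ints_of_nat Ints_of_int)
  next
    case False
    then have "of_nat (nat b) * (of_nat D * s) \<in> \<int>" using Ints_mult[OF Ints_of_nat D(2)[of s]] s by simp
    then show ?thesis by (simp add: mult_ac)
  qed
  then show ?case using D(1) ab(1) by (intro exI[of _ "D * nat b"]) auto
qed

text \<open>Commensurability writes every element of \<Lambda> as an integral matrix times one of
  finitely many representatives, and a common denominator of the representatives suffices.\<close>

lemma bounded_denominators:
  assumes "arithmetic_lattice n \<Lambda>"
  shows "\<exists>D>0. \<forall>A\<in>\<Lambda>. \<forall>i<n. \<forall>j<n. of_nat D * A $$ (i, j) \<in> \<int>"
proof -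
  from assms obtain G where G: "subgroup \<Lambda> ((GL n)\<lparr>carrier := G \<inter> GL_Q n\<rparr>)"
    "finite_index_subgroup (GL n) (\<Lambda> \<inter> (G \<inter> GL_Z n)) \<Lambda>"
    by (auto simp: arithmetic_lattice_def commensurable_def)
  have grp: "group ((GL n)\<lparr>carrier := \<Lambda>\<rparr>)"
    using group.subgroup_imp_group[OF group_GL arithmetic_lattice_subgroup[OF assms]] .
  have Q: "A \<in> carrier_mat n n" "\<forall>i<n. \<forall>j<n. A $$ (i, j) \<in> \<rat>" if "A \<in> \<Lambda>" for A
  proof -
    have "A \<in> GL_Q n" using subgroup.subset[OF G(1)] that by auto
    then show "A \<in> carrier_mat n n" by (auto simp: GL_Q_def intro: GL_carrier)
    with \<open>A \<in> GL_Q n\<close> show "\<forall>i<n. \<forall>j<n. A $$ (i, j) \<in> \<rat>"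
      by (simp add: GL_Q_def elements_mat_subset_iff)
  qed
  from finite_index_residues[OF grp G(2)] obtain f :: "complex mat \<Rightarrow> complex mat set" where f: "finite (f ` \<Lambda>)"
    "\<forall>x\<in>\<Lambda>. \<forall>y\<in>\<Lambda>. f x = f y \<longrightarrow> (\<exists>h\<in>\<Lambda> \<inter> (G \<inter> GL_Z n). y = h \<otimes>\<^bsub>GL n\<^esub> x)"
    by (elim exE conjE)
  obtain X where X: "X \<subseteq> \<Lambda>" "finite X" "f ` \<Lambda> = f ` X"
    using finite_subset_image[OF f(1) order_refl] by metis
  have "finite ((\<lambda>(A, i, j). A $$ (i, j)) ` (X \<times> {..<n} \<times> {..<n}))"
    using X(2) by auto
  from common_denominator[OF this] obtain D where D: "D > 0"
    "\<And>A i j. A \<in> X \<Longrightarrow> i < n \<Longrightarrow> j < n \<Longrightarrow> of_nat D * A $$ (i, j) \<in> \<int>"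
    using Q X(1) by fastforce
  have "of_nat D * A $$ (i, j) \<in> \<int>" if A: "A \<in> \<Lambda>" and ij: "i < n" "j < n" for A i j
  proof -
    obtain B where B: "B \<in> X" "f B = f A" using A X(3) by (metis imageE imageI)
    then obtain h where h: "h \<in> GL_Z n" "A = h * B"
      using f(2)[rule_format, of B A] A X(1) by auto
    have "h \<in> carrier_mat n n" "\<And>i j. i < n \<Longrightarrow> j < n \<Longrightarrow> h $$ (i, j) \<in> \<int>"
      using h(1) GL_carrier by (auto simp: GL_Z_def elements_mat_subset_iff)
    moreover have "B \<in> carrier_mat n n" using Q(1) B(1) X(1) by auto
    ultimately have h': "h \<in> carrier_mat n n" "B \<in> carrier_mat n n"
      "\<And>i j. i < n \<Longrightarrow> j < n \<Longrightarrow> h $$ (i, j) \<in> \<int>" by auto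
    have eq: "of_nat D * A $$ (i, j) = (\<Sum>k<n. h $$ (i, k) * (of_nat D * B $$ (k, j)))"
      unfolding h(2) mat_mult_index[OF h'(1,2) ij] sum_distrib_left
      by (intro sum.cong refl mult.left_commute)
    show ?thesis
      unfolding eq using Ints_mult[OF h'(3)[OF ij(1)] D(2)[OF B(1) _ ij(2)]] by (intro Ints_sum) simp
  qed
  with D(1) show ?thesis by blast
qed

section \<open>An order containing the lattice\<close>

text \<open>Column by column these are the vectors that all of \<Lambda> sends into Z^n. When
  \<Lambda> contains 1 and \<open>D\<close> clears its denominators, they form a lattice between D
  Z^n and Z^n.\<close>

definition stable_matrices :: "nat \<Rightarrow> complex mat set \<Rightarrow> complex mat set" where
  "stable_matrices n \<Lambda> = {X \<in> carrier_mat n n. \<forall>A\<in>\<Lambda>. \<forall>i<n. \<forall>j<n. (A * X) $$ (i, j) \<in> \<int>}"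

text \<open>The left multiplier ring of that lattice. It is closed under the ring operations by
  construction, so there is no need to control denominators of sums of products from
  \<Lambda>.\<close>

definition stabiliser_order :: "nat \<Rightarrow> complex mat set \<Rightarrow> complex mat set" where
  "stabiliser_order n \<Lambda> =
     {A \<in> carrier_mat n n. \<forall>X\<in>stable_matrices n \<Lambda>. A * X \<in> stable_matrices n \<Lambda>}"

lemma stabiliser_order_diff:
  assumes "\<Lambda> \<subseteq> carrier_mat n n" "A \<in> stabiliser_order n \<Lambda>" "B \<in> stabiliser_order n \<Lambda>"
  shows "A - B \<in> stabiliser_order n \<Lambda>"
proof -
  have AB: "A \<in> carrier_mat n n" "B \<in> carrier_mat n n" using assms by (auto simp: stabiliser_order_def)
  have "(A - B) * X \<in> stable_matrices n \<Lambda>" if "X \<in> stable_matrices n \<Lambda>" for X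
  proof -
    have X: "X \<in> carrier_mat n n" "A * X \<in> stable_matrices n \<Lambda>" "B * X \<in> stable_matrices n \<Lambda>"
      using that assms by (auto simp: stabiliser_order_def stable_matrices_def)
    have "(L * ((A - B) * X)) $$ (i, j) \<in> \<int>" if L: "L \<in> \<Lambda>" and ij: "i < n" "j < n" for L i j
    proof -
      have Lc: "L \<in> carrier_mat n n" using L assms(1) by auto
      have "L * ((A - B) * X) = L * (A * X) - L * (B * X)"
        unfolding minus_mult_distrib_mat[OF AB X(1)]
        by (rule mult_minus_distrib_mat[OF Lc mult_carrier_mat[OF AB(1) X(1)] mult_carrier_mat[OF AB(2) X(1)]])
      moreover have "(L * (A * X)) $$ (i, j) \<in> \<int>" "(L * (B * X)) $$ (i, j) \<in> \<int>"
        using X(2,3) L ij by (auto simp: stable_matrices_def)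
      ultimately show ?thesis using AB X(1) Lc ij by auto
    qed
    then show ?thesis using AB X(1) by (auto simp: stable_matrices_def)
  qed
  then show ?thesis using AB by (auto simp: stabiliser_order_def)
qed

lemma stabiliser_order_mult:
  assumes "A \<in> stabiliser_order n \<Lambda>" "B \<in> stabiliser_order n \<Lambda>"
  shows "A * B \<in> stabiliser_order n \<Lambda>"
  using assms by (auto simp: stabiliser_order_def stable_matrices_def)

lemma one_stabiliser_order: "1\<^sub>m n \<in> stabiliser_order n \<Lambda>"
  by (auto simp: stabiliser_order_def stable_matrices_def)

lemma subset_stabiliser_order:
  assumes "\<Lambda> \<subseteq> carrier_mat n n" "\<And>A B. A \<in> \<Lambda> \<Longrightarrow> B \<in> \<Lambda> \<Longrightarrow> A * B \<in> \<Lambda>"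
  shows "\<Lambda> \<subseteq> stabiliser_order n \<Lambda>"
proof
  fix B assume B: "B \<in> \<Lambda>"
  have "B * X \<in> stable_matrices n \<Lambda>" if X: "X \<in> stable_matrices n \<Lambda>" for X
  proof -
    have "A * (B * X) = A * B * X" if "A \<in> \<Lambda>" for A
      using that B assms(1) X by (intro assoc_mult_mat[symmetric, of _ n n _ n _ n]) (auto simp: stable_matrices_def)
    then show ?thesis using X B assms by (auto simp: stable_matrices_def)
  qed
  then show "B \<in> stabiliser_order n \<Lambda>" using B assms(1) by (auto simp: stabiliser_order_def)
qed

text \<open>The scalar matrix \<open>D\<close> is itself stable, so \<open>A\<close> times it is
  stable too, and testing this against the identity in \<Lambda> shows that \<open>D A\<close> is
  integral.\<close>

lemma stabiliser_order_denominator: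
  assumes "\<And>A i j. A \<in> \<Lambda> \<Longrightarrow> i < n \<Longrightarrow> j < n \<Longrightarrow> of_nat D * A $$ (i, j) \<in> \<int>"
    and "\<Lambda> \<subseteq> carrier_mat n n" "1\<^sub>m n \<in> \<Lambda>" "A \<in> stabiliser_order n \<Lambda>" "i < n" "j < n"
  shows "of_nat D * A $$ (i, j) \<in> \<int>"
proof -
  let ?D = "of_nat D \<cdot>\<^sub>m 1\<^sub>m n :: complex mat"
  have scalar: "B * ?D = of_nat D \<cdot>\<^sub>m B" if "B \<in> carrier_mat n n" for B
    using that by (simp add: mult_smult_distrib[of _ n n _ n])
  have "?D \<in> stable_matrices n \<Lambda>"
    using assms(1,2) scalar by (auto simp: stable_matrices_def subset_iff)
  then have "A * ?D \<in> stable_matrices n \<Lambda>" using assms(4) by (auto simp: stabiliser_order_def)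
  moreover have A: "A \<in> carrier_mat n n" using assms(4) by (simp add: stabiliser_order_def)
  ultimately have "of_nat D \<cdot>\<^sub>m A \<in> stable_matrices n \<Lambda>" by (simp only: scalar)
  then have "(1\<^sub>m n * (of_nat D \<cdot>\<^sub>m A)) $$ (i, j) \<in> \<int>"
    using assms(3,5,6) by (auto simp: stable_matrices_def)
  then show ?thesis using A assms(5,6) by simp
qed

text \<open>On the order the scaled entry is already an integer, so \<open>Re\<close> and the floor
  only change its type and preserve sums there.\<close>

definition mat_coord :: "nat \<Rightarrow> nat \<Rightarrow> nat \<Rightarrow> endo \<Rightarrow> int" where
  "mat_coord n D k x =
     \<lfloor>Re (of_nat D * inv_into (carrier_mat n n) (mat_endo n) x $$ (k div n, k mod n))\<rfloor>"

lemma mat_coord_eq: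
  assumes "n > 0" "A \<in> carrier_mat n n"
  shows "mat_coord n D k (mat_endo n A) = \<lfloor>Re (of_nat D * A $$ (k div n, k mod n))\<rfloor>"
  using assms by (simp add: mat_coord_def inv_into_f_f[OF mat_endo_inj])

text \<open>
  The locale asks for additivity of every coordinate, and the ones beyond \<open>n * n\<close> would read
  unspecified matrix entries; hence the cutoff.
\<close>

lemma lattice_ring_stabiliser_order:
  assumes n: "n > 0" and D: "D > 0"
    and den: "\<And>A i j. A \<in> \<Lambda> \<Longrightarrow> i < n \<Longrightarrow> j < n \<Longrightarrow> of_nat D * A $$ (i, j) \<in> \<int>"
    and \<Lambda>: "\<Lambda> \<subseteq> carrier_mat n n" "1\<^sub>m n \<in> \<Lambda>"
  shows "lattice_ring (mat_endo n ` stabiliser_order n \<Lambda>) (n * n)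
    (\<lambda>k x. if k < n * n then mat_coord n D k x else 0)"
proof
  let ?S = "stabiliser_order n \<Lambda>"
  let ?\<phi> = "\<lambda>k x. if k < n * n then mat_coord n D k x else 0"
  have S: "A \<in> carrier_mat n n" if "A \<in> ?S" for A using that by (simp add: stabiliser_order_def)
  have ij: "k div n < n" "k mod n < n" if "k < n * n" for k
    using that n by (auto simp: less_mult_imp_div_less)
  have int: "of_nat D * A $$ (k div n, k mod n) \<in> \<int>" if "A \<in> ?S" "k < n * n" for A k
    using stabiliser_order_denominator[OF den \<Lambda> that(1) ij[OF that(2)]] .
  show "1 \<in> mat_endo n ` ?S"
    using one_stabiliser_order[of n \<Lambda>] mat_endo_one[OF n] by (metis imageI)
  fix x y assume "x \<in> mat_endo n ` ?S" "y \<in> mat_endo n ` ?S"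
  then obtain A B where A: "A \<in> ?S" "x = mat_endo n A" and B: "B \<in> ?S" "y = mat_endo n B" by auto
  show "x - y \<in> mat_endo n ` ?S"
    using stabiliser_order_diff[OF \<Lambda>(1) A(1) B(1)] mat_endo_diff[OF n] S A B by (metis imageI)
  show "x * y \<in> mat_endo n ` ?S"
    using stabiliser_order_mult[OF A(1) B(1)] mat_endo_mult[OF n] S A B by (metis imageI)
  show "?\<phi> k (x + y) = ?\<phi> k x + ?\<phi> k y" for k
  proof (cases "k < n * n")
    case True
    have AB: "A \<in> carrier_mat n n" "B \<in> carrier_mat n n" "A + B \<in> carrier_mat n n" using S A B by auto
    obtain a b where ab: "of_nat D * A $$ (k div n, k mod n) = of_int a"
      "of_nat D * B $$ (k div n, k mod n) = of_int b"
      using int[OF A(1) True] int[OF B(1) True] by (elim Ints_cases)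
    have "of_nat D * (A + B) $$ (k div n, k mod n) = of_int (a + b)"
      using AB ij[OF True] ab by (simp add: distrib_left)
    then show ?thesis
      unfolding A(2) B(2) mat_endo_add[OF n AB(1,2), symmetric] mat_coord_eq[OF n AB(1)]
        mat_coord_eq[OF n AB(2)] mat_coord_eq[OF n AB(3)] ab by simp
  qed simp
next
  let ?S = "stabiliser_order n \<Lambda>"
  fix x assume "x \<in> mat_endo n ` ?S"
    and 0: "\<And>k. k < n * n \<Longrightarrow> (if k < n * n then mat_coord n D k x else 0) = 0"
  then obtain A where A: "A \<in> ?S" "x = mat_endo n A" by auto
  have Ac: "A \<in> carrier_mat n n" using A(1) by (simp add: stabiliser_order_def)
  have "A $$ (i, j) = 0" if ij: "i < n" "j < n" for i j
  proof -
    have "i * n + j < n * n"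
      using ij by (metis add.commute add_less_cancel_left less_le_trans mult.commute mult_Suc mult_le_mono2 Suc_leI)
    then have fl: "\<lfloor>Re (of_nat D * A $$ (i, j))\<rfloor> = 0"
      using 0[of "i * n + j"] ij by (simp add: A(2) mat_coord_eq[OF n Ac])
    obtain z where z: "of_nat D * A $$ (i, j) = of_int z"
      using stabiliser_order_denominator[OF den \<Lambda> A(1) ij] by (rule Ints_cases)
    from fl have "of_nat D * A $$ (i, j) = 0" unfolding z by simp
    then show ?thesis using D by simp
  qed
  then have "A = 0\<^sub>m n n" using Ac by (intro eq_matI) auto
  then have "A - A = A" by auto
  then show "x = 0" using mat_endo_diff[OF n Ac Ac] by (simp add: A(2))
qed

section \<open>Auxiliary facts on inverses, powers and conjugates\<close>

lemma subgroup_GL_D: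
  assumes "subgroup H (GL n)"
  shows "A \<in> H \<Longrightarrow> A \<in> carrier_mat n n" "1\<^sub>m n \<in> H" "A \<in> H \<Longrightarrow> B \<in> H \<Longrightarrow> A * B \<in> H"
    "A \<in> H \<Longrightarrow> inv\<^bsub>GL n\<^esub> A \<in> H" "A \<in> H \<Longrightarrow> A * inv\<^bsub>GL n\<^esub> A = 1\<^sub>m n"
    "A \<in> H \<Longrightarrow> inv\<^bsub>GL n\<^esub> A * A = 1\<^sub>m n"
  using subgroup.mem_carrier[OF assms] GL_carrier GL_inv subgroup.one_closed[OF assms]
    subgroup.m_closed[OF assms, of A B] subgroup.m_inv_closed[OF assms] by auto

lemma mat_endo_pow:
  fixes k :: nat
  assumes "n > 0" "A \<in> carrier (GL n)"
  shows "mat_endo n (A [^]\<^bsub>GL n\<^esub> k) = mat_endo n A ^ k"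
proof (induction k)
  case 0 then show ?case using mat_endo_one[OF assms(1)] by (simp add: group.is_monoid[OF group_GL] monoid.nat_pow_0)
next
  case (Suc k)
  have "A [^]\<^bsub>GL n\<^esub> k \<in> carrier (GL n)"
    using monoid.nat_pow_closed[OF group.is_monoid[OF group_GL] assms(2)] .
  with Suc assms show ?case
    by (simp add: monoid.nat_pow_Suc[OF group.is_monoid[OF group_GL]] mat_endo_mult GL_carrier power_Suc2 del: power_Suc)
qed

lemma (in group) conj_pow:
  assumes "x \<in> carrier G" "y \<in> carrier G"
  shows "inv y \<otimes> x [^] k \<otimes> y = (inv y \<otimes> x \<otimes> y) [^] (k::nat)"
proof (induction k)
  case (Suc k)
  have "inv y \<otimes> x [^] Suc k \<otimes> y = inv y \<otimes> x [^] k \<otimes> (y \<otimes> inv y) \<otimes> x \<otimes> y"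
    using assms by (simp add: m_assoc del: r_inv)
  also have "\<dots> = (inv y \<otimes> x [^] k \<otimes> y) \<otimes> (inv y \<otimes> x \<otimes> y)"
    using assms by (simp only: m_assoc m_closed inv_closed nat_pow_closed)
  finally show ?case using Suc by simp
qed (use assms in simp)

section \<open>The torsion free subgroup\<close>

theorem corollary5p3:
  fixes n :: nat and \<Lambda> \<Gamma> :: "complex mat set"
  assumes "arithmetic_lattice n \<Lambda>"
    and "subgroup \<Gamma> ((GL n)\<lparr>carrier := \<Lambda>\<rparr>)"
    and "torsion_free (GL n) \<Gamma>"
    and "virtually_unipotent n \<Gamma>"
  shows "\<exists>\<Lambda>\<^sub>0. finite_index_subgroup (GL n) \<Lambda>\<^sub>0 \<Lambda> \<and> torsion_free (GL n) \<Lambda>\<^sub>0 \<and>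
           subgroup \<Gamma> ((GL n)\<lparr>carrier := \<Lambda>\<^sub>0\<rparr>)"
proof -
  interpret GL: group "GL n" by (rule group_GL)
  have \<Lambda>: "subgroup \<Lambda> (GL n)" by (rule arithmetic_lattice_subgroup) fact
  have \<Lambda>grp: "group ((GL n)\<lparr>carrier := \<Lambda>\<rparr>)" by (rule GL.subgroup_imp_group[OF \<Lambda>])
  have \<Gamma>_sub: "subgroup \<Gamma> (GL n)" by (rule GL.incl_subgroup[OF \<Lambda> assms(2)])
  have \<Gamma>\<Lambda>: "\<Gamma> \<subseteq> \<Lambda>" using subgroup.subset[OF assms(2)] by simp
  note \<Lambda>D = subgroup_GL_D[OF \<Lambda>] and \<Gamma>D = subgroup_GL_D[OF \<Gamma>_sub]
  show ?thesis
  proof (cases "n = 0")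
    \<comment> \<open>The embedding into \<open>endo\<close> requires positive size; for
      \<open>n = 0\<close> the lattice is trivial and serves as its own subgroup.\<close>
    case True
    have triv: "A = 1\<^sub>m n" if "A \<in> \<Lambda>" for A using \<Lambda>D(1)[OF that] True by auto
    have "finite_index_subgroup (GL n) \<Lambda> \<Lambda>"
    proof (rule finite_index_subgroupI[OF \<Lambda>grp, where f = "\<lambda>_. ()"])
      show "subgroup \<Lambda> ((GL n)\<lparr>carrier := \<Lambda>\<rparr>)" by (rule GL.subgroup_incl[OF \<Lambda> \<Lambda> order_refl])
      fix x y assume "x \<in> \<Lambda>" "y \<in> \<Lambda>"
      then show "\<exists>h\<in>\<Lambda>. y = h \<otimes>\<^bsub>GL n\<^esub> x"
        using triv[of x] triv[of y] \<Lambda>D(2) by (intro bexI[of _ "1\<^sub>m n"]) auto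
    qed auto
    moreover have "torsion_free (GL n) \<Lambda>" using triv by (auto simp: torsion_free_def)
    ultimately show ?thesis using assms(2) by blast
  next
    case False
    then have n: "n > 0" by simp
    from bounded_denominators[OF assms(1)] obtain D where D: "D > 0"
      "\<And>A i j. A \<in> \<Lambda> \<Longrightarrow> i < n \<Longrightarrow> j < n \<Longrightarrow> of_nat D * A $$ (i, j) \<in> \<int>" by blast
    let ?\<iota> = "mat_endo n" and ?R = "mat_endo n ` stabiliser_order n \<Lambda>"
    have \<Lambda>c: "\<Lambda> \<subseteq> carrier_mat n n" using \<Lambda>D(1) by auto
    interpret lattice_ring ?R "n * n" "\<lambda>k x. if k < n * n then mat_coord n D k x else 0"
      by (rule lattice_ring_stabiliser_order[OF n D \<Lambda>c \<Lambda>D(2)])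
    have \<Lambda>S: "\<Lambda> \<subseteq> stabiliser_order n \<Lambda>" by (rule subset_stabiliser_order[OF \<Lambda>c \<Lambda>D(3)])
    have Sc: "A \<in> carrier_mat n n" if "A \<in> stabiliser_order n \<Lambda>" for A
      using that by (simp add: stabiliser_order_def)
    have ugrp: "unit_group (?\<iota> ` H)" if H: "subgroup H (GL n)" "H \<subseteq> \<Lambda>" for H
    proof -
      note HD = subgroup_GL_D[OF H(1)]
      have "?\<iota> A * ?\<iota> B \<in> ?\<iota> ` H" if "A \<in> H" "B \<in> H" for A B
        using mat_endo_mult[OF n HD(1)[OF that(1)] HD(1)[OF that(2)]] HD(3)[OF that] by (metis imageI)
      moreover have "\<exists>y\<in>?\<iota> ` H. ?\<iota> A * y = 1 \<and> y * ?\<iota> A = 1" if "A \<in> H" for A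
      proof (intro bexI[of _ "?\<iota> (inv\<^bsub>GL n\<^esub> A)"] conjI imageI)
        note A = HD(1)[OF that] HD(1)[OF HD(4)[OF that]]
        show "?\<iota> A * ?\<iota> (inv\<^bsub>GL n\<^esub> A) = 1" "?\<iota> (inv\<^bsub>GL n\<^esub> A) * ?\<iota> A = 1"
          using mat_endo_mult[OF n A(1,2)] mat_endo_mult[OF n A(2,1)] HD(5,6)[OF that] mat_endo_one[OF n]
          by auto
      qed (rule HD(4)[OF that])
      moreover have "1 \<in> ?\<iota> ` H" using mat_endo_one[OF n] HD(2) by (metis imageI)
      ultimately show ?thesis using H(2) \<Lambda>S unfolding unit_group_def by auto
    qed
    from assms(4) obtain U P where U: "subgroup U (GL n)" "finite_index_subgroup (GL n) U \<Gamma>"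
      and P: "P \<in> carrier (GL n)" "\<And>A. A \<in> U \<Longrightarrow> P * A * inv\<^bsub>GL n\<^esub> P \<in> unitriangular n"
      by (auto simp: virtually_unipotent_def unipotent_subgroup_def)
    have U\<Gamma>: "U \<subseteq> \<Gamma>"
      using U(2) subgroup.subset by (fastforce simp: finite_index_subgroup_def)
    obtain e :: nat where e: "e > 0" "\<And>x. x \<in> \<Gamma> \<Longrightarrow> x [^]\<^bsub>GL n\<^esub> e \<in> U"
      using finite_index_power[OF group_GL \<Gamma>_sub U(2)] by blast
    have \<Gamma>G: "x \<in> carrier (GL n)" if "x \<in> \<Gamma>" for x using subgroup.mem_carrier[OF \<Gamma>_sub that] .
    \<comment> \<open>The normal core of \<open>U\<close> in \<Gamma>. The exponent \<open>e\<close>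
      works for it as well, since a conjugate of an \<open>e\<close>-th power is the
      \<open>e\<close>-th power of an element of \<Gamma>.\<close>
    define U\<^sub>0 where "U\<^sub>0 = {u \<in> U. \<forall>g\<in>\<Gamma>. inv\<^bsub>GL n\<^esub> g \<otimes>\<^bsub>GL n\<^esub> u \<otimes>\<^bsub>GL n\<^esub> g \<in> U}"
    interpret unipotent_flag ?R "n * n" "\<lambda>k x. if k < n * n then mat_coord n D k x else 0"
      "?\<iota> ` \<Gamma>" "?\<iota> ` U\<^sub>0" e
    proof
      show "unit_group (?\<iota> ` \<Gamma>)" by (rule ugrp[OF \<Gamma>_sub \<Gamma>\<Lambda>])
      show "?\<iota> ` U\<^sub>0 \<subseteq> ?\<iota> ` \<Gamma>" using U\<Gamma> by (auto simp: U\<^sub>0_def)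
      show "e > 0" by (rule e(1))
      fix y assume "y \<in> ?\<iota> ` \<Gamma>"
      then obtain g where g: "g \<in> \<Gamma>" "y = ?\<iota> g" by auto
      note gG = \<Gamma>G[OF g(1)]
      have "inv\<^bsub>GL n\<^esub> h \<otimes>\<^bsub>GL n\<^esub> g [^]\<^bsub>GL n\<^esub> e \<otimes>\<^bsub>GL n\<^esub> h \<in> U" if h: "h \<in> \<Gamma>" for h
        unfolding GL.conj_pow[OF gG \<Gamma>G[OF h]]
        by (intro e(2) subgroup.m_closed[OF \<Gamma>_sub] subgroup.m_inv_closed[OF \<Gamma>_sub] g(1) h)
      then have "g [^]\<^bsub>GL n\<^esub> e \<in> U\<^sub>0" unfolding U\<^sub>0_def using e(2)[OF g(1)] by auto
      then show "y ^ e \<in> ?\<iota> ` U\<^sub>0" unfolding g(2) mat_endo_pow[OF n gG, symmetric] by (rule imageI)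
      fix x assume "x \<in> ?\<iota> ` U\<^sub>0"
      then obtain u where u: "u \<in> U\<^sub>0" "x = ?\<iota> u" by auto
      then have u\<Gamma>: "u \<in> \<Gamma>" using U\<Gamma> by (auto simp: U\<^sub>0_def)
      note uG = \<Gamma>G[OF u\<Gamma>]
      define u' where "u' = inv\<^bsub>GL n\<^esub> g \<otimes>\<^bsub>GL n\<^esub> u \<otimes>\<^bsub>GL n\<^esub> g"
      have u'\<Gamma>: "u' \<in> \<Gamma>"
        unfolding u'_def by (intro subgroup.m_closed[OF \<Gamma>_sub] subgroup.m_inv_closed[OF \<Gamma>_sub] g(1) u\<Gamma>)
      have "inv\<^bsub>GL n\<^esub> h \<otimes>\<^bsub>GL n\<^esub> u' \<otimes>\<^bsub>GL n\<^esub> h \<in> U" if h: "h \<in> \<Gamma>" for h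
      proof -
        have "inv\<^bsub>GL n\<^esub> h \<otimes>\<^bsub>GL n\<^esub> u' \<otimes>\<^bsub>GL n\<^esub> h
            = inv\<^bsub>GL n\<^esub> (g \<otimes>\<^bsub>GL n\<^esub> h) \<otimes>\<^bsub>GL n\<^esub> u \<otimes>\<^bsub>GL n\<^esub> (g \<otimes>\<^bsub>GL n\<^esub> h)"
          unfolding u'_def GL.inv_mult_group[OF gG \<Gamma>G[OF h]]
          using uG gG \<Gamma>G[OF h] by (simp only: GL.m_assoc GL.m_closed GL.inv_closed)
        moreover have "g \<otimes>\<^bsub>GL n\<^esub> h \<in> \<Gamma>" using subgroup.m_closed[OF \<Gamma>_sub g(1) h] .
        ultimately show ?thesis using u(1) unfolding U\<^sub>0_def by auto
      qed
      moreover have "u' \<in> U" using u(1) g(1) unfolding U\<^sub>0_def u'_def by blast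
      ultimately have "u' \<in> U\<^sub>0" unfolding U\<^sub>0_def by blast
      moreover have "u \<otimes>\<^bsub>GL n\<^esub> g = g \<otimes>\<^bsub>GL n\<^esub> u'"
        unfolding u'_def using uG gG by (simp only: GL.m_assoc[symmetric] GL.m_closed GL.inv_closed GL.r_inv GL.l_one)
      then have "x * y = y * ?\<iota> u'"
        unfolding u(2) g(2)
        using mat_endo_mult[OF n \<Gamma>D(1)[OF u\<Gamma>] \<Gamma>D(1)[OF g(1)]]
          mat_endo_mult[OF n \<Gamma>D(1)[OF g(1)] \<Gamma>D(1)[OF u'\<Gamma>]] by simp
      ultimately show "\<exists>u'\<in>?\<iota> ` U\<^sub>0. x * y = y * u'" by blast
    qed
    \<comment> \<open>Conjugation by \<open>P\<close> makes \<open>u - 1\<close> strictly upper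
      triangular, so multiplying by it clears one more row of \<open>P * M\<close> from the bottom.
      For \<open>j = n\<close> the row condition is empty, which puts 1 into
      \<open>flag n\<close>.\<close>
    have in_flag: "?\<iota> M \<in> flag j"
      if "M \<in> stabiliser_order n \<Lambda>" "\<And>i k. j \<le> i \<Longrightarrow> i < n \<Longrightarrow> k < n \<Longrightarrow> (P * M) $$ (i, k) = 0" for j M
      using that
    proof (induction j arbitrary: M)
      case 0
      have Mc: "M \<in> carrier_mat n n" using Sc[OF 0(1)] .
      note Pc = GL_carrier[OF P(1)]
      have "P * M = 0\<^sub>m n n" using 0(2) Mc Pc by (intro eq_matI) auto
      then have "inv\<^bsub>GL n\<^esub> P * P * M = 0\<^sub>m n n"
        using GL_inv(1)[OF P(1)] Mc Pc by (simp add: assoc_mult_mat[of _ n n _ n _ n])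
      then have "M = 0\<^sub>m n n" using GL_inv(3)[OF P(1)] Mc by simp
      then have "M = M - M" by auto
      then have "?\<iota> M = ?\<iota> M - ?\<iota> M" using mat_endo_diff[OF n Mc Mc] by metis
      then show ?case by simp
    next
      case (Suc j)
      have Mc: "M \<in> carrier_mat n n" using Sc[OF Suc.prems(1)] .
      note Pc = GL_carrier[OF P(1)]
      have "(?\<iota> u - 1) * ?\<iota> M \<in> flag j" if u: "u \<in> U\<^sub>0" for u
      proof -
        have uU: "u \<in> U" "u \<in> \<Gamma>" using u U\<Gamma> by (auto simp: U\<^sub>0_def)
        have uc: "u \<in> carrier_mat n n" using \<Gamma>D(1)[OF uU(2)] .
        have uS: "u \<in> stabiliser_order n \<Lambda>" using uU(2) \<Gamma>\<Lambda> \<Lambda>S by auto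
        define T where "T = P * u * inv\<^bsub>GL n\<^esub> P"
        have T: "T \<in> carrier_mat n n" "upper_triangular T" "\<And>i. i < n \<Longrightarrow> T $$ (i, i) = 1"
          using P(2)[OF uU(1)] by (auto simp: T_def unitriangular_def)
        have "T * (P * M) = P * u * (inv\<^bsub>GL n\<^esub> P * P) * M"
          unfolding T_def using GL_inv(1)[OF P(1)] Pc uc Mc
          by (simp add: assoc_mult_mat[of _ n n _ n _ n])
        then have TPM: "T * (P * M) = P * (u * M)"
          using GL_inv(3)[OF P(1)] Pc uc Mc by (simp add: assoc_mult_mat[of _ n n _ n _ n])
        let ?M = "(u - 1\<^sub>m n) * M"
        have M': "?M = u * M - M" using uc Mc by (simp add: minus_mult_distrib_mat)
        have "(P * ?M) $$ (i, k) = 0" if ik: "j \<le> i" "i < n" "k < n" for i k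
        proof -
          have "(T * (P * M)) $$ (i, k) = (\<Sum>l<n. T $$ (i, l) * (P * M) $$ (l, k))"
            using mat_mult_index[OF T(1) _ ik(2,3), of "P * M"] Pc Mc by auto
          \<comment> \<open>Terms with \<open>l < i\<close> vanish by triangularity; for
            \<open>l > i\<close> one has \<open>l \<ge> Suc j\<close>, where the rows of
            \<open>P * M\<close> are zero.\<close>
          also have "\<dots> = (\<Sum>l<n. if l = i then (P * M) $$ (i, k) else 0)"
          proof (intro sum.cong refl)
            fix l assume "l \<in> {..<n}"
            then show "T $$ (i, l) * (P * M) $$ (l, k) = (if l = i then (P * M) $$ (i, k) else 0)"
              using T(3)[OF ik(2)] upper_triangularD[OF T(2), of l i] T(1) ik Suc.prems(2)[of l k]
              by (cases l i rule: linorder_cases) auto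
          qed
          also have "\<dots> = (P * M) $$ (i, k)" using ik(2) by simp
          finally have "(P * (u * M)) $$ (i, k) = (P * M) $$ (i, k)" unfolding TPM .
          moreover have "P * ?M = P * (u * M) - P * M"
            unfolding M' using Pc uc Mc by (intro mult_minus_distrib_mat) auto
          ultimately show ?thesis using Pc uc Mc ik by simp
        qed
        moreover have "?M \<in> stabiliser_order n \<Lambda>"
          using stabiliser_order_mult[OF stabiliser_order_diff[OF \<Lambda>c uS one_stabiliser_order] Suc.prems(1)] .
        ultimately have "?\<iota> ?M \<in> flag j" by (intro Suc.IH)
        moreover have "?\<iota> ?M = (?\<iota> u - 1) * ?\<iota> M"
          using mat_endo_mult[OF n minus_carrier_mat[OF one_carrier_mat] Mc, of u]
            mat_endo_diff[OF n uc one_carrier_mat] mat_endo_one[OF n] by simp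
        ultimately show ?thesis by simp
      qed
      then show ?case using Suc.prems(1) by auto
    qed
    have nil: "1 \<in> flag n"
      using in_flag[OF one_stabiliser_order, of n] mat_endo_one[OF n] by simp
    have pow_one: "?\<iota> x ^ k = 1 \<longleftrightarrow> x [^]\<^bsub>GL n\<^esub> k = 1\<^sub>m n" if "x \<in> \<Lambda>" for x and k :: nat
    proof -
      have xG: "x \<in> carrier (GL n)" using subgroup.mem_carrier[OF \<Lambda> that] .
      have "?\<iota> (x [^]\<^bsub>GL n\<^esub> k) = ?\<iota> (1\<^sub>m n) \<longleftrightarrow> x [^]\<^bsub>GL n\<^esub> k = 1\<^sub>m n"
        using GL_carrier[OF GL.nat_pow_closed[OF xG]] by (intro inj_on_eq_iff[OF mat_endo_inj[OF n]]) auto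
      then show ?thesis by (simp add: mat_endo_pow[OF n xG] mat_endo_one[OF n])
    qed
    have one_iff: "?\<iota> x = 1 \<longleftrightarrow> x = 1\<^sub>m n" if "x \<in> \<Lambda>" for x
      using inj_on_eq_iff[OF mat_endo_inj[OF n] \<Lambda>D(1)[OF that], of "1\<^sub>m n"] mat_endo_one[OF n] by simp
    have tf: "g = 1" if g: "g \<in> ?\<iota> ` \<Gamma>" "k > 0" "g ^ k = 1" for g k
    proof -
      obtain x where x: "x \<in> \<Gamma>" "g = ?\<iota> x" using g(1) by auto
      then have "x = 1\<^sub>m n"
        using assms(3) g(2,3) pow_one[of x k] \<Gamma>\<Lambda> by (auto simp: torsion_free_def)
      then show ?thesis using x(2) mat_endo_one[OF n] by simp
    qed
    have "\<exists>m>0. \<forall>x\<in>?\<iota> ` \<Lambda>. \<forall>g\<in>?\<iota> ` \<Gamma>. \<forall>r>0. congr m x g \<longrightarrow> x ^ r = 1 \<longrightarrow> x = 1"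
      by (rule torsion_free_thickening[OF _ nil ugrp[OF \<Lambda> order_refl]]) (rule tf)
    then obtain m where m: "m > 0" "\<And>x g r. x \<in> \<Lambda> \<Longrightarrow> g \<in> \<Gamma> \<Longrightarrow> r > 0 \<Longrightarrow>
        congr m (?\<iota> x) (?\<iota> g) \<Longrightarrow> ?\<iota> x ^ r = 1 \<Longrightarrow> ?\<iota> x = 1"
      by auto
    \<comment> \<open>This is the product of \<Gamma> with the congruence subgroup, written as the
      elements whose residue occurs in \<Gamma>; closure under the group operations then follows
      from compatibility of congruences.\<close>
    define \<Lambda>\<^sub>0 where "\<Lambda>\<^sub>0 = {x \<in> \<Lambda>. \<exists>g\<in>\<Gamma>. congr m (?\<iota> x) (?\<iota> g)}"
    have \<iota>R: "?\<iota> x \<in> ?R" if "x \<in> \<Lambda>" for x using that \<Lambda>S by auto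
    have inv: "?\<iota> (inv\<^bsub>GL n\<^esub> x) * ?\<iota> x = 1" "?\<iota> x * ?\<iota> (inv\<^bsub>GL n\<^esub> x) = 1" if "x \<in> \<Lambda>" for x
      using mat_endo_mult[OF n \<Lambda>D(1)[OF \<Lambda>D(4)[OF that]] \<Lambda>D(1)[OF that]]
        mat_endo_mult[OF n \<Lambda>D(1)[OF that] \<Lambda>D(1)[OF \<Lambda>D(4)[OF that]]]
        \<Lambda>D(5,6)[OF that] mat_endo_one[OF n] by auto
    have \<Lambda>\<^sub>0: "subgroup \<Lambda>\<^sub>0 (GL n)"
    proof (rule GL.subgroupI)
      show "\<Lambda>\<^sub>0 \<subseteq> carrier (GL n)" using subgroup.subset[OF \<Lambda>] by (auto simp: \<Lambda>\<^sub>0_def)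
      show "\<Lambda>\<^sub>0 \<noteq> {}" using \<Lambda>D(2) \<Gamma>D(2) by (auto simp: \<Lambda>\<^sub>0_def intro!: exI[of _ "1\<^sub>m n"] bexI[of _ "1\<^sub>m n"])
      fix a assume "a \<in> \<Lambda>\<^sub>0"
      then obtain g where a: "a \<in> \<Lambda>" "g \<in> \<Gamma>" "congr m (?\<iota> a) (?\<iota> g)" by (auto simp: \<Lambda>\<^sub>0_def)
      have g: "g \<in> \<Lambda>" using a(2) \<Gamma>\<Lambda> by auto
      let ?a = "inv\<^bsub>GL n\<^esub> a" and ?g = "inv\<^bsub>GL n\<^esub> g"
      \<comment> \<open>Multiplying the congruence of \<open>a\<close> and \<open>g\<close> by the
        inverse of \<open>a\<close> on the left and that of \<open>g\<close> on the right makes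
        their inverses congruent.\<close>
      have "congr m (?\<iota> ?a * ?\<iota> a * ?\<iota> ?g) (?\<iota> ?a * ?\<iota> g * ?\<iota> ?g)"
        by (intro congr_mult_left congr_mult_right a \<iota>R \<Lambda>D(4) g)
      then have "congr m (?\<iota> ?g) (?\<iota> ?a)" using inv(1)[OF a(1)] inv(2)[OF g] by (simp add: mult.assoc)
      from congr_sym[OF this] show "?a \<in> \<Lambda>\<^sub>0"
        using \<Lambda>D(4)[OF a(1)] \<Gamma>D(4)[OF a(2)] by (auto simp: \<Lambda>\<^sub>0_def)
      fix b assume "b \<in> \<Lambda>\<^sub>0"
      then obtain h where b: "b \<in> \<Lambda>" "h \<in> \<Gamma>" "congr m (?\<iota> b) (?\<iota> h)" by (auto simp: \<Lambda>\<^sub>0_def)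
      have h: "h \<in> \<Lambda>" using b(2) \<Gamma>\<Lambda> by auto
      have "congr m (?\<iota> a * ?\<iota> b) (?\<iota> g * ?\<iota> h)"
        by (intro congr_mult a b \<iota>R g)
      then have "congr m (?\<iota> (a * b)) (?\<iota> (g * h))"
        by (simp add: mat_endo_mult[OF n] \<Lambda>D(1) a(1) b(1) g h)
      then show "a \<otimes>\<^bsub>GL n\<^esub> b \<in> \<Lambda>\<^sub>0"
        using \<Lambda>D(3)[OF a(1) b(1)] \<Gamma>D(3)[OF a(2) b(2)] by (auto simp: \<Lambda>\<^sub>0_def)
    qed
    obtain f :: "endo \<Rightarrow> int list" where f: "finite (f ` ?R)"
      "\<And>x y. x \<in> ?R \<Longrightarrow> y \<in> ?R \<Longrightarrow> f x = f y \<Longrightarrow> congr m x y"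
      using finite_residues[OF m(1)] by metis
    have "finite_index_subgroup (GL n) \<Lambda>\<^sub>0 \<Lambda>"
    proof (rule finite_index_subgroupI[OF \<Lambda>grp, where f = "\<lambda>x. f (?\<iota> x)"])
      show "subgroup \<Lambda>\<^sub>0 ((GL n)\<lparr>carrier := \<Lambda>\<rparr>)"
        by (rule GL.subgroup_incl[OF \<Lambda>\<^sub>0 \<Lambda>]) (auto simp: \<Lambda>\<^sub>0_def)
      show "finite ((\<lambda>x. f (?\<iota> x)) ` \<Lambda>)"
        by (rule finite_subset[OF _ f(1)]) (use \<iota>R in auto)
      fix x y assume xy: "x \<in> \<Lambda>" "y \<in> \<Lambda>" "f (?\<iota> x) = f (?\<iota> y)"
      let ?x = "inv\<^bsub>GL n\<^esub> x"
      \<comment> \<open>Elements with equal residues differ by an element congruent to 1, which lies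
        in \<open>\<Lambda>\<^sub>0\<close> because 1 belongs to \<Gamma>.\<close>
      have "congr m (?\<iota> y) (?\<iota> x)" using f(2)[OF \<iota>R \<iota>R] xy by simp
      from congr_mult_right[OF this \<iota>R[OF \<Lambda>D(4)[OF xy(1)]]]
      have "congr m (?\<iota> (y * ?x)) (?\<iota> (1\<^sub>m n))"
        by (simp add: inv(2)[OF xy(1)] mat_endo_mult[OF n] mat_endo_one[OF n] \<Lambda>D(1,4) xy)
      then have "y * ?x \<in> \<Lambda>\<^sub>0" using \<Lambda>D(3)[OF xy(2) \<Lambda>D(4)[OF xy(1)]] \<Gamma>D(2) by (auto simp: \<Lambda>\<^sub>0_def)
      moreover have "y = (y * ?x) * x"
        using \<Lambda>D(1)[OF xy(1)] \<Lambda>D(1)[OF xy(2)] \<Lambda>D(1)[OF \<Lambda>D(4)[OF xy(1)]] \<Lambda>D(6)[OF xy(1)]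
        by (simp add: assoc_mult_mat[of _ n n _ n _ n])
      ultimately show "\<exists>h\<in>\<Lambda>\<^sub>0. y = h \<otimes>\<^bsub>GL n\<^esub> x" by (intro bexI[of _ "y * ?x"]) auto
    qed
    moreover have "torsion_free (GL n) \<Lambda>\<^sub>0"
      unfolding torsion_free_def
    proof (intro ballI allI impI)
      fix x and k :: nat assume "x \<in> \<Lambda>\<^sub>0" "k > 0" "x [^]\<^bsub>GL n\<^esub> k = \<one>\<^bsub>GL n\<^esub>"
      then show "x = \<one>\<^bsub>GL n\<^esub>"
        using m(2)[of x _ k] pow_one[of x k] one_iff[of x] by (auto simp: \<Lambda>\<^sub>0_def)
    qed
    moreover have "subgroup \<Gamma> ((GL n)\<lparr>carrier := \<Lambda>\<^sub>0\<rparr>)"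
      using \<Gamma>\<Lambda> by (intro GL.subgroup_incl[OF \<Gamma>_sub \<Lambda>\<^sub>0]) (auto simp: \<Lambda>\<^sub>0_def intro: congr_refl)
    ultimately show ?thesis by blast
  qed
qed

end
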